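(* Let $(\Gamma,K)$ be a canonical bilinear lattice of tubular type, let $n=\mathrm{rk}(\Gamma)$, and let $c\in W$ be the corresponding Coxeter element. Then $\ell_T(c)=n$.
   Context: Symbol: integers $t\ge0$, $\varepsilon\in\{1,2\}$, $p_1,\dots,p_t\ge2$, $d_i,f_i\ge1$ with $f_i\mid d_i$; put $e_i=d_i/f_i$, $n=\sum_{i=1}^t(p_i-1)+2$. Tubular type means $\delta=\sum_{i=1}^t\varepsilon d_i(1-\frac1{p_i})-2=0$. The canonical bilinear lattice $(\Gamma,K)$ is the free abelian group with ordered basis $$R=(\alpha_{(t,p_t-1)},\dots,\alpha_{(t,1)},\dots,\alpha_{(1,p_1-1)},\dots,\alpha_{(1,1)},\alpha_0,\alpha_{0^*})$$ with bilinear form $K=\langle-,-\rangle$ given, for some $\kappa\in\mathbb{N}$, $\kappa\ge1$, with all $\frac{\kappa\varepsilon f_i}{e_i}\in\mathbb{N}$, by $\langle\alpha_{(i,j)},\alpha_{(i,j)}\rangle=\frac{\kappa\varepsilon f_i}{e_i}$ $(1\le j\le p_i-1)$; $\langle\alpha_{(i,j)},\alpha_{(i,j-1)}\rangle=-\frac{\kappa\varepsilon f_i}{e_i}$ for $2\le j\le p_i-1$; $\langle\alpha_{(i,1)},\alpha_0\rangle=-\kappa\varepsilon f_i$; $\langle\alpha_{(i,1)},\alpha_{0^*}\rangle=-\kappa\varepsilon^2f_i$; $\langle\alpha_0,\alpha_0\rangle=\kappa$, $\langle\alpha_0,\alpha_{0^*}\rangle=2\kappa\varepsilon$, $\langle\alpha_{0^*},\alpha_{0^*}\rangle=\kappa\varepsilon^2$;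 all other values on basis pairs are $0$. $B=(-,-)$ is the symmetrization $(\alpha,\beta)=\langle\alpha,\beta\rangle+\langle\beta,\alpha\rangle$. For $\alpha\in R$, $s_\alpha(\gamma)=\gamma-2\frac{(\gamma,\alpha)}{(\alpha,\alpha)}\alpha$. $W$ is the subgroup of the isometry group of $(\Gamma,B)$ generated by $S=\{s_\alpha\mid\alpha\in R\}$; $T$ is the set of $W$-conjugates of elements of $S$; the Coxeter element $c$ is the product of the $s_\alpha$, $\alpha\in R$, in the order of $R$. $\ell_T(w)$ is the minimal $r$ such that $w$ is a product of $r$ elements of $T$. *)

theory Defs
  imports Complex_Main "HOL-Algebra.Bij" "HOL-Algebra.Generated_Groups" "HOL-Algebra.Free_Abelian_Groups"
begin

section \<open>Symbols\<close>

text \<open>The entries of a symbol, indexed by \<open>i \<in> {1..t}\<close>; the values of \<open>wt\<close>, \<open>dd\<close>, \<open>ff\<close>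
  at other indices are irrelevant.\<close>

record symbol =
  arms :: nat              \<comment> \<open>\<open>t\<close>\<close>
  eps :: nat               \<comment> \<open>\<open>\<epsilon>\<close>\<close>
  wt :: "nat \<Rightarrow> nat"       \<comment> \<open>\<open>p\<^sub>i\<close>\<close>
  dd :: "nat \<Rightarrow> nat"       \<comment> \<open>\<open>d\<^sub>i\<close>\<close>
  ff :: "nat \<Rightarrow> nat"       \<comment> \<open>\<open>f\<^sub>i\<close>\<close>

definition is_symbol :: "symbol \<Rightarrow> bool" where
  "is_symbol \<sigma> \<longleftrightarrow> eps \<sigma> \<in> {1, 2} \<and>
     (\<forall>i\<in>{1..arms \<sigma>}. wt \<sigma> i \<ge> 2 \<and> dd \<sigma> i \<ge> 1 \<and> ff \<sigma> i \<ge> 1 \<and> ff \<sigma> i dvd dd \<sigma> i)"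

definition ee :: "symbol \<Rightarrow> nat \<Rightarrow> nat" where
  "ee \<sigma> i = dd \<sigma> i div ff \<sigma> i"

definition rank :: "symbol \<Rightarrow> nat" where
  "rank \<sigma> = (\<Sum>i = 1..arms \<sigma>. wt \<sigma> i - 1) + 2"

definition tubular :: "symbol \<Rightarrow> bool" where
  "tubular \<sigma> \<longleftrightarrow>
     (\<Sum>i = 1..arms \<sigma>. real (eps \<sigma>) * real (dd \<sigma> i) * (1 - 1 / real (wt \<sigma> i))) - 2 = 0"

definition admissible :: "symbol \<Rightarrow> nat \<Rightarrow> bool" where
  "admissible \<sigma> \<kappa> \<longleftrightarrow> \<kappa> \<ge> 1 \<and> (\<forall>i\<in>{1..arms \<sigma>}. ee \<sigma> i dvd \<kappa> * eps \<sigma> * ff \<sigma> i)"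

section \<open>Canonical bilinear lattices\<close>

text \<open>Labels of the basis elements \<open>\<alpha>\<^bsub>(i,j)\<^esub>\<close>, \<open>\<alpha>\<^sub>0\<close> and \<open>\<alpha>\<^bsub>0*\<^esub>\<close>.\<close>

datatype vertex = Arm nat nat | Zero | ZeroStar

definition basis :: "symbol \<Rightarrow> vertex list" where
  "basis \<sigma> = concat (map (\<lambda>i. map (Arm i) (rev [1..<wt \<sigma> i])) (rev [1..<Suc (arms \<sigma>)]))
              @ [Zero, ZeroStar]"

definition lattice :: "symbol \<Rightarrow> (vertex \<Rightarrow>\<^sub>0 int) monoid" where
  "lattice \<sigma> = free_Abelian_group (set (basis \<sigma>))"

fun gram :: "symbol \<Rightarrow> nat \<Rightarrow> vertex \<Rightarrow> vertex \<Rightarrow> int" where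
  "gram \<sigma> \<kappa> (Arm i j) (Arm i' j') =
     (if i = i' \<and> j = j' then int (\<kappa> * eps \<sigma> * ff \<sigma> i div ee \<sigma> i)
      else if i = i' \<and> j = Suc j' then - int (\<kappa> * eps \<sigma> * ff \<sigma> i div ee \<sigma> i)
      else 0)"
| "gram \<sigma> \<kappa> (Arm i j) Zero = (if j = 1 then - int (\<kappa> * eps \<sigma> * ff \<sigma> i) else 0)"
| "gram \<sigma> \<kappa> (Arm i j) ZeroStar = (if j = 1 then - int (\<kappa> * (eps \<sigma>)^2 * ff \<sigma> i) else 0)"
| "gram \<sigma> \<kappa> Zero Zero = int \<kappa>"
| "gram \<sigma> \<kappa> Zero ZeroStar = int (2 * \<kappa> * eps \<sigma>)"
| "gram \<sigma> \<kappa> ZeroStar ZeroStar = int (\<kappa> * (eps \<sigma>)^2)"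
| "gram \<sigma> \<kappa> Zero (Arm i j) = 0"
| "gram \<sigma> \<kappa> ZeroStar (Arm i j) = 0"
| "gram \<sigma> \<kappa> ZeroStar Zero = 0"

definition Kform :: "symbol \<Rightarrow> nat \<Rightarrow> (vertex \<Rightarrow>\<^sub>0 int) \<Rightarrow> (vertex \<Rightarrow>\<^sub>0 int) \<Rightarrow> int" where
  "Kform \<sigma> \<kappa> x y =
     (\<Sum>a\<in>set (basis \<sigma>). \<Sum>b\<in>set (basis \<sigma>).
        Poly_Mapping.lookup x a * Poly_Mapping.lookup y b * gram \<sigma> \<kappa> a b)"

definition Bform :: "symbol \<Rightarrow> nat \<Rightarrow> (vertex \<Rightarrow>\<^sub>0 int) \<Rightarrow> (vertex \<Rightarrow>\<^sub>0 int) \<Rightarrow> int" where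
  "Bform \<sigma> \<kappa> x y = Kform \<sigma> \<kappa> x y + Kform \<sigma> \<kappa> y x"

section \<open>The reflection group and the Coxeter element\<close>

definition isometry_group :: "symbol \<Rightarrow> nat \<Rightarrow> ((vertex \<Rightarrow>\<^sub>0 int) \<Rightarrow> (vertex \<Rightarrow>\<^sub>0 int)) monoid" where
  "isometry_group \<sigma> \<kappa> = BijGroup (carrier (lattice \<sigma>))
     \<lparr>carrier := {\<phi> \<in> auto (lattice \<sigma>). \<forall>x\<in>carrier (lattice \<sigma>). \<forall>y\<in>carrier (lattice \<sigma>).
                    Bform \<sigma> \<kappa> (\<phi> x) (\<phi> y) = Bform \<sigma> \<kappa> x y}\<rparr>"

text \<open>For basis elements the integer division below is exact; see \<open>reflection_exact\<close>.
  The map is restricted to the lattice because elements of \<open>BijGroup\<close> are extensional.\<close>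

definition reflection ::
  "symbol \<Rightarrow> nat \<Rightarrow> (vertex \<Rightarrow>\<^sub>0 int) \<Rightarrow> (vertex \<Rightarrow>\<^sub>0 int) \<Rightarrow> (vertex \<Rightarrow>\<^sub>0 int)" where
  "reflection \<sigma> \<kappa> \<alpha> = (\<lambda>\<gamma> \<in> carrier (lattice \<sigma>).
     \<gamma> - frag_cmul (2 * Bform \<sigma> \<kappa> \<gamma> \<alpha> div Bform \<sigma> \<kappa> \<alpha> \<alpha>) \<alpha>)"

definition simple_reflections ::
  "symbol \<Rightarrow> nat \<Rightarrow> ((vertex \<Rightarrow>\<^sub>0 int) \<Rightarrow> (vertex \<Rightarrow>\<^sub>0 int)) set" where
  "simple_reflections \<sigma> \<kappa> = (\<lambda>a. reflection \<sigma> \<kappa> (frag_of a)) ` set (basis \<sigma>)"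

definition weyl_group ::
  "symbol \<Rightarrow> nat \<Rightarrow> ((vertex \<Rightarrow>\<^sub>0 int) \<Rightarrow> (vertex \<Rightarrow>\<^sub>0 int)) set" where
  "weyl_group \<sigma> \<kappa> = generate (isometry_group \<sigma> \<kappa>) (simple_reflections \<sigma> \<kappa>)"

definition reflections ::
  "symbol \<Rightarrow> nat \<Rightarrow> ((vertex \<Rightarrow>\<^sub>0 int) \<Rightarrow> (vertex \<Rightarrow>\<^sub>0 int)) set" where
  "reflections \<sigma> \<kappa> =
     {w \<otimes>\<^bsub>isometry_group \<sigma> \<kappa>\<^esub> s \<otimes>\<^bsub>isometry_group \<sigma> \<kappa>\<^esub> inv\<^bsub>isometry_group \<sigma> \<kappa>\<^esub> w
      | w s. w \<in> weyl_group \<sigma> \<kappa> \<and> s \<in> simple_reflections \<sigma> \<kappa>}"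

definition product_list :: "('a, 'b) monoid_scheme \<Rightarrow> 'a list \<Rightarrow> 'a" where
  "product_list G xs = foldr (mult G) xs \<one>\<^bsub>G\<^esub>"

definition coxeter :: "symbol \<Rightarrow> nat \<Rightarrow> (vertex \<Rightarrow>\<^sub>0 int) \<Rightarrow> (vertex \<Rightarrow>\<^sub>0 int)" where
  "coxeter \<sigma> \<kappa> = product_list (isometry_group \<sigma> \<kappa>)
     (map (\<lambda>a. reflection \<sigma> \<kappa> (frag_of a)) (basis \<sigma>))"

definition reflection_length ::
  "symbol \<Rightarrow> nat \<Rightarrow> ((vertex \<Rightarrow>\<^sub>0 int) \<Rightarrow> (vertex \<Rightarrow>\<^sub>0 int)) \<Rightarrow> nat" where
  "reflection_length \<sigma> \<kappa> w =
     (LEAST r. \<exists>ts. length ts = r \<and> set ts \<subseteq> reflections \<sigma> \<kappa>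
                  \<and> product_list (isometry_group \<sigma> \<kappa>) ts = w)"

section \<open>Well-definedness\<close>

lemma set_basis:
  "set (basis \<sigma>) = {Arm i j | i j. 1 \<le> i \<and> i \<le> arms \<sigma> \<and> 1 \<le> j \<and> j < wt \<sigma> i} \<union> {Zero, ZeroStar}"
  by (auto simp: basis_def)

lemma length_basis: "length (basis \<sigma>) = rank \<sigma>"
proof -
  have "sum_list (map (\<lambda>i. wt \<sigma> i - 1) (rev [1..<Suc (arms \<sigma>)])) = (\<Sum>i = 1..arms \<sigma>. wt \<sigma> i - 1)"
    by (subst sum_list_distinct_conv_sum_set)
       (simp_all add: atLeastLessThanSuc_atLeastAtMost del: upt_Suc)
  then show ?thesis
    by (simp add: basis_def rank_def length_concat comp_def del: upt_Suc)
qed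

lemma distinct_basis: "distinct (basis \<sigma>)"
proof -
  have "distinct (concat (map (\<lambda>i. map (Arm i) (rev [1..<wt \<sigma> i])) is))" if "distinct is" for "is"
    using that by (induction "is") (auto simp: distinct_map inj_on_def)
  from this[of "rev [1..<Suc (arms \<sigma>)]"] show ?thesis
    by (auto simp: basis_def)
qed

lemma Kform_add: "Kform \<sigma> \<kappa> (x + y) z = Kform \<sigma> \<kappa> x z + Kform \<sigma> \<kappa> y z"
                 "Kform \<sigma> \<kappa> z (x + y) = Kform \<sigma> \<kappa> z x + Kform \<sigma> \<kappa> z y"
  by (simp_all add: Kform_def lookup_add algebra_simps sum.distrib)

lemma Kform_cmul: "Kform \<sigma> \<kappa> (frag_cmul k x) z = k * Kform \<sigma> \<kappa> x z"
                  "Kform \<sigma> \<kappa> z (frag_cmul k x) = k * Kform \<sigma> \<kappa> z x"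
  by (simp_all add: Kform_def sum_distrib_left mult_ac)

lemma Kform_basis:
  assumes "a \<in> set (basis \<sigma>)" "b \<in> set (basis \<sigma>)"
  shows "Kform \<sigma> \<kappa> (frag_of a) (frag_of b) = gram \<sigma> \<kappa> a b"
proof -
  have "Kform \<sigma> \<kappa> (frag_of a) (frag_of b) =
      (\<Sum>a'\<in>set (basis \<sigma>). \<Sum>b'\<in>set (basis \<sigma>). if a' = a then (if b' = b then gram \<sigma> \<kappa> a b else 0) else 0)"
    unfolding Kform_def by (intro sum.cong refl) auto
  also have "\<dots> = (\<Sum>a'\<in>set (basis \<sigma>). if a' = a then gram \<sigma> \<kappa> a b else 0)"
    using assms by (intro sum.cong refl) auto
  finally show ?thesis using assms by simp
qed

lemma Bform_add: "Bform \<sigma> \<kappa> (x + y) z = Bform \<sigma> \<kappa> x z + Bform \<sigma> \<kappa> y z"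
                 "Bform \<sigma> \<kappa> z (x + y) = Bform \<sigma> \<kappa> z x + Bform \<sigma> \<kappa> z y"
  by (simp_all add: Bform_def Kform_add)

lemma Bform_cmul: "Bform \<sigma> \<kappa> (frag_cmul k x) z = k * Bform \<sigma> \<kappa> x z"
                  "Bform \<sigma> \<kappa> z (frag_cmul k x) = k * Bform \<sigma> \<kappa> z x"
  by (simp_all add: Bform_def Kform_cmul algebra_simps)

lemma Bform_sym: "Bform \<sigma> \<kappa> x y = Bform \<sigma> \<kappa> y x"
  by (simp add: Bform_def)

lemma Bform_diff: "Bform \<sigma> \<kappa> (x - y) z = Bform \<sigma> \<kappa> x z - Bform \<sigma> \<kappa> y z"
                  "Bform \<sigma> \<kappa> z (x - y) = Bform \<sigma> \<kappa> z x - Bform \<sigma> \<kappa> z y"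
  using Bform_add(1)[of \<sigma> \<kappa> "x - y" y z] Bform_add(2)[of \<sigma> \<kappa> z "x - y" y] by simp_all

lemma reflection_exact_basis:
  assumes "is_symbol \<sigma>" "admissible \<sigma> \<kappa>" "a \<in> set (basis \<sigma>)" "b \<in> set (basis \<sigma>)"
  shows "Bform \<sigma> \<kappa> (frag_of a) (frag_of a) dvd 2 * Bform \<sigma> \<kappa> (frag_of b) (frag_of a)"
proof -
  have eps: "eps \<sigma> = 1 \<or> eps \<sigma> = 2" using assms(1) by (auto simp: is_symbol_def)
  have q: "int (\<kappa> * eps \<sigma> * ff \<sigma> i div ee \<sigma> i) dvd int \<kappa> * int (eps \<sigma>) * int (ff \<sigma> i)"
    if "1 \<le> i" "i \<le> arms \<sigma>" for i
  proof -
    have "ee \<sigma> i dvd \<kappa> * eps \<sigma> * ff \<sigma> i" using assms(2) that by (auto simp: admissible_def)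
    then have "\<kappa> * eps \<sigma> * ff \<sigma> i div ee \<sigma> i dvd \<kappa> * eps \<sigma> * ff \<sigma> i"
      by (metis dvd_div_mult_self dvd_triv_left)
    then show ?thesis by (metis of_nat_dvd_iff of_nat_mult)
  qed
  have q2: "int (\<kappa> * eps \<sigma> * ff \<sigma> i div ee \<sigma> i) dvd int \<kappa> * (int (eps \<sigma>))\<^sup>2 * int (ff \<sigma> i)"
    if "1 \<le> i" "i \<le> arms \<sigma>" for i
  proof -
    have "int \<kappa> * (int (eps \<sigma>))\<^sup>2 * int (ff \<sigma> i) = (int \<kappa> * int (eps \<sigma>) * int (ff \<sigma> i)) * int (eps \<sigma>)"
      by (simp add: power2_eq_square)
    then show ?thesis using q[OF that] by (metis dvd_mult2)
  qed
  have "gram \<sigma> \<kappa> a a dvd gram \<sigma> \<kappa> a b + gram \<sigma> \<kappa> b a"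
  proof (cases a)
    case (Arm i j)
    then have "1 \<le> i" "i \<le> arms \<sigma>" using assms(3) by (auto simp: set_basis)
    then show ?thesis using Arm q[of i] q2[of i] by (cases b) simp_all
  next
    case Zero
    then show ?thesis by (cases b) simp_all
  next
    case ZeroStar
    then show ?thesis using eps by (cases b) auto
  qed
  then have "2 * gram \<sigma> \<kappa> a a dvd 2 * (gram \<sigma> \<kappa> b a + gram \<sigma> \<kappa> a b)"
    by (simp only: add.commute mult_dvd_mono dvd_refl)
  then show ?thesis using assms by (simp add: Bform_def Kform_basis)
qed

lemma carrier_lattice: "x \<in> carrier (lattice \<sigma>) \<longleftrightarrow> Poly_Mapping.keys x \<subseteq> set (basis \<sigma>)"
  by (simp add: lattice_def)

lemma reflection_exact:
  assumes "is_symbol \<sigma>" "admissible \<sigma> \<kappa>" "a \<in> set (basis \<sigma>)" "\<gamma> \<in> carrier (lattice \<sigma>)"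
  shows "Bform \<sigma> \<kappa> (frag_of a) (frag_of a) dvd 2 * Bform \<sigma> \<kappa> \<gamma> (frag_of a)"
proof -
  have "Poly_Mapping.keys \<gamma> \<subseteq> set (basis \<sigma>)" using assms(4) by (simp add: carrier_lattice)
  then show ?thesis
  proof (induction \<gamma> rule: frag_induction)
    case zero then show ?case by (simp add: Bform_def Kform_def)
  next
    case (one x) then show ?case using reflection_exact_basis assms by blast
  next
    case (diff x y) then show ?case by (simp add: Bform_diff right_diff_distrib dvd_diff)
  qed
qed

lemma Bform_basis_pos:
  assumes "is_symbol \<sigma>" "admissible \<sigma> \<kappa>" "a \<in> set (basis \<sigma>)"
  shows "Bform \<sigma> \<kappa> (frag_of a) (frag_of a) > 0"
proof -
  have k: "\<kappa> \<ge> 1" and e: "eps \<sigma> \<ge> 1" using assms by (auto simp: admissible_def is_symbol_def)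
  have "\<kappa> * eps \<sigma> * ff \<sigma> i div ee \<sigma> i > 0" if "1 \<le> i" "i \<le> arms \<sigma>" for i
  proof -
    have "ff \<sigma> i \<ge> 1" using assms(1) that unfolding is_symbol_def by simp
    then have "\<kappa> * eps \<sigma> * ff \<sigma> i > 0" using k e by simp
    moreover have "ee \<sigma> i dvd \<kappa> * eps \<sigma> * ff \<sigma> i"
      using assms(2) that by (simp add: admissible_def)
    ultimately show ?thesis by (metis dvd_div_eq_0_iff gr0I less_irrefl)
  qed
  then have "gram \<sigma> \<kappa> a a > 0"
    using assms(3)[unfolded set_basis] k e by (auto simp flip: of_nat_mult)
  then show ?thesis by (simp add: Bform_def Kform_basis assms(3))
qed

lemma reflection_in_isometry_group:
  assumes "is_symbol \<sigma>" "admissible \<sigma> \<kappa>" "a \<in> set (basis \<sigma>)"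
  shows "reflection \<sigma> \<kappa> (frag_of a) \<in> carrier (isometry_group \<sigma> \<kappa>)"
proof -
  define L where "L = carrier (lattice \<sigma>)"
  define B where "B = Bform \<sigma> \<kappa>"
  define \<alpha> where "\<alpha> = frag_of a"
  define k where "k \<gamma> = 2 * B \<gamma> \<alpha> div B \<alpha> \<alpha>" for \<gamma>
  define r where "r = reflection \<sigma> \<kappa> \<alpha>"
  have pos: "B \<alpha> \<alpha> > 0" using Bform_basis_pos[OF assms] by (simp add: B_def \<alpha>_def)
  have k: "k \<gamma> * B \<alpha> \<alpha> = 2 * B \<gamma> \<alpha>" if "\<gamma> \<in> L" for \<gamma>
    using reflection_exact[OF assms] that by (simp add: k_def B_def \<alpha>_def L_def)
  have r: "r \<gamma> = \<gamma> - frag_cmul (k \<gamma>) \<alpha>" if "\<gamma> \<in> L" for \<gamma>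
    using that by (simp add: r_def reflection_def k_def B_def L_def)
  have \<alpha>L: "\<alpha> \<in> L" using assms(3) by (simp add: L_def carrier_lattice \<alpha>_def)
  have cl: "x - frag_cmul m y \<in> L" if "x \<in> L" "y \<in> L" for x y m
    using that keys_diff[of x "frag_cmul m y"] keys_cmul[of m y]
    unfolding L_def carrier_lattice by blast
  have rL: "r \<gamma> \<in> L" if "\<gamma> \<in> L" for \<gamma> using cl[OF that \<alpha>L] by (simp add: r that)
  have add: "x + y \<in> L" if "x \<in> L" "y \<in> L" for x y
    using that Poly_Mapping.keys_add[of x y] unfolding L_def carrier_lattice by blast
  have inv: "r (r \<gamma>) = \<gamma>" if g: "\<gamma> \<in> L" for \<gamma>
  proof -
    have "k (r \<gamma>) * B \<alpha> \<alpha> = - k \<gamma> * B \<alpha> \<alpha>"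
      using k[OF rL[OF g]] k[OF g] by (simp add: r[OF g] B_def Bform_diff Bform_cmul)
    then have "k (r \<gamma>) = - k \<gamma>" using pos mult_cancel_right[of "k (r \<gamma>)" "B \<alpha> \<alpha>" "- k \<gamma>"] by simp
    then show ?thesis by (simp add: r[OF rL[OF g]]) (simp add: r[OF g] flip: minus_frag_cmul)
  qed
  have "bij_betw r L L" by (rule bij_betw_byWitness[of _ r]) (auto simp: inv rL)
  then have bij: "r \<in> Bij L" by (simp add: Bij_def r_def reflection_def L_def)
  have hom: "r (x + y) = r x + r y" if x: "x \<in> L" and y: "y \<in> L" for x y
  proof -
    have "k (x + y) * B \<alpha> \<alpha> = (k x + k y) * B \<alpha> \<alpha>"
      using k[OF add[OF x y]] k[OF x] k[OF y] by (simp add: B_def Bform_add algebra_simps)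
    then have "k (x + y) = k x + k y" using pos by simp
    then show ?thesis by (simp add: r x y add frag_cmul_distrib)
  qed
  have iso: "B (r x) (r y) = B x y" if x: "x \<in> L" and y: "y \<in> L" for x y
  proof -
    have "B (r x) (r y) = B x y - k y * B x \<alpha> - k x * B y \<alpha> + k x * (k y * B \<alpha> \<alpha>)"
      using Bform_sym[of \<sigma> \<kappa> \<alpha> y]
      by (simp add: r x y B_def Bform_diff Bform_cmul algebra_simps)
    moreover have "k x * (k y * B \<alpha> \<alpha>) = 2 * (k x * B y \<alpha>)" by (simp add: k[OF y])
    moreover have "k x * (k y * B \<alpha> \<alpha>) = 2 * (k y * B x \<alpha>)"
      using k[OF x] by (metis mult.left_commute)
    ultimately show ?thesis by linarith
  qed
  have "r \<in> auto (lattice \<sigma>)"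
    using bij hom rL by (auto simp: auto_def hom_def L_def lattice_def)
  then show ?thesis
    using iso by (simp add: isometry_group_def r_def B_def L_def \<alpha>_def)
qed

lemma group_isometry_group: "group (isometry_group \<sigma> \<kappa>)"
proof -
  define L where "L = carrier (lattice \<sigma>)"
  define I where "I = carrier (isometry_group \<sigma> \<kappa>)"
  have I: "I = {\<phi> \<in> auto (lattice \<sigma>). \<forall>x\<in>L. \<forall>y\<in>L. Bform \<sigma> \<kappa> (\<phi> x) (\<phi> y) = Bform \<sigma> \<kappa> x y}"
    by (simp add: I_def isometry_group_def L_def)
  interpret A: subgroup "auto (lattice \<sigma>)" "BijGroup L"
    unfolding L_def lattice_def by (rule group.subgroup_auto) simp
  have bij: "\<phi> \<in> Bij L" if "\<phi> \<in> auto (lattice \<sigma>)" for \<phi>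
    using that by (simp add: auto_def L_def)
  have "subgroup I (BijGroup L)"
  proof (rule subgroup.intro)
    show "I \<subseteq> carrier (BijGroup L)" using A.subset by (auto simp: I)
    show "\<one>\<^bsub>BijGroup L\<^esub> \<in> I" using A.one_closed by (auto simp: I BijGroup_def)
  next
    fix x y assume "x \<in> I" "y \<in> I"
    then show "x \<otimes>\<^bsub>BijGroup L\<^esub> y \<in> I"
      using A.m_closed[of x y] bij[of x] bij[of y] Bij_imp_funcset[of y L]
      by (auto simp: I BijGroup_def compose_def Pi_iff)
  next
    fix x assume x: "x \<in> I"
    then have b: "x \<in> Bij L" and iso: "\<And>u v. u \<in> L \<Longrightarrow> v \<in> L \<Longrightarrow> Bform \<sigma> \<kappa> (x u) (x v) = Bform \<sigma> \<kappa> u v"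
      using bij by (auto simp: I)
    have "Bform \<sigma> \<kappa> (inv_into L x u) (inv_into L x v) = Bform \<sigma> \<kappa> u v" if "u \<in> L" "v \<in> L" for u v
      using iso[of "inv_into L x u" "inv_into L x v"] b that Bij_inv_into_mem[OF b]
      by (simp add: Bij_def bij_betw_inv_into_right[of x L L])
    then show "inv\<^bsub>BijGroup L\<^esub> x \<in> I"
      using A.m_inv_closed[of x] x by (auto simp: I inv_BijGroup[OF b])
  qed
  then have "group (BijGroup L\<lparr>carrier := I\<rparr>)"
    by (rule subgroup.subgroup_is_group) (rule group_BijGroup)
  then show ?thesis by (simp add: I_def isometry_group_def L_def)
qed

end

theory Submission
  imports Defs "Jordan_Normal_Form.Determinant"
begin

text \<open>
  Write \<open>K\<close> for the bilinear form, \<open>B\<close> for its symmetrization, \<open>n\<close> for the rank and \<open>c\<close> for the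
  Coxeter element.  By definition \<open>c\<close> is a product of \<open>n\<close> reflections, so the point is that fewer do
  not suffice.  In tubular type this cannot be read off from fixed spaces: \<open>B\<close> is positive
  semidefinite with a radical of rank 2, on which \<open>c\<close> acts trivially, and the codimension of the fixed
  space of \<open>c\<close> is only \<open>n - 2\<close>.

  Since reflections have determinant \<open>-1\<close> (\<open>det_product_list\<close>), a factorisation
  \<open>c = t\<^sub>1 \<cdots> t\<^sub>m\<close> with \<open>m < n\<close> has \<open>m \<le> n - 2\<close>.  Let \<open>\<beta>\<^sub>i\<close> be a root of \<open>t\<^sub>i\<close>.  Counting equations yields
  \<open>y\<close> that is not fixed by \<open>c\<close> but is orthogonal to \<open>\<beta>\<^sub>2, \<dots>, \<beta>\<^sub>m\<close>; then \<open>y - c y\<close> is a nonzero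
  multiple of \<open>\<beta>\<^sub>1\<close>.  The form \<open>K\<close> is triangular in the ordered basis, and this gives
  \<open>K x (y - c y) = B x y\<close> for all \<open>x\<close> (\<open>K_coxeter\<close>).  For \<open>x\<close> in the radical the right-hand side
  vanishes, so \<open>\<beta>\<^sub>1\<close> is a root that is \<open>K\<close>-orthogonal to the radical
  (\<open>short_factorization_gives_root\<close>).

  No such root exists (\<open>no_root_radical_orth\<close>).  On a weighted projective line, the two linear
  conditions say that a class has rank zero and degree zero; the first confines the class to the
  arms, up to a multiple of a radical vector, and the second reads
  \<open>b + (\<Sum>i. f\<^sub>i S\<^sub>i / p\<^sub>i) = 0\<close>, where \<open>S\<^sub>i\<close> is the sum of the coordinates on the \<open>i\<close>-th arm and \<open>b\<close> is
  the coordinate at \<open>\<alpha>\<^bsub>0*\<^esub>\<close>.  Comparing the norm of a root with the integrality of its coroot shows that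
  only one arm \<open>i\<close> is involved and that the root restricts to a root of type \<open>A\<close> there, whence
  \<open>0 < \<bar>S\<^sub>i\<bar> < p\<^sub>i\<close> (\<open>root_on_one_arm\<close>).  Integrality of \<open>b\<close> and of the coroot then require \<open>p\<^sub>i\<close> to divide
  \<open>f\<^sub>i S\<^sub>i\<close> and \<open>\<epsilon> e\<^sub>i S\<^sub>i\<close>, and the tubular equation leaves just one possibility: a single arm with
  \<open>p = f = \<epsilon> e = 2\<close>.  There a parity invariant of roots gives the contradiction
  (\<open>exceptional_parity\<close>).
\<close>

section \<open>Sums along a chain\<close>

text \<open>The quadratic form of the root lattice \<open>A\<^bsub>p-1\<^esub>\<close>, half the usual norm, when \<open>u\<close> vanishes at
  both ends \<open>0\<close> and \<open>p\<close>.\<close>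

definition chain_form :: "nat \<Rightarrow> (nat \<Rightarrow> int) \<Rightarrow> int" where
  "chain_form p u = (\<Sum>j = 1..<p. u j * (u j - u (j - 1)))"

lemma chain_form_scale: "chain_form p (\<lambda>j. c * u j) = c\<^sup>2 * chain_form p u"
  by (simp add: chain_form_def sum_distrib_left power2_eq_square algebra_simps)

lemma chain_form_eq_sum_squares:
  assumes "u 0 = 0" "u p = 0"
  shows "2 * chain_form p u = (\<Sum>j = 1..p. (u j - u (j - 1))\<^sup>2)"
proof -
  have *: "2 * (\<Sum>j = 1..m. u j * (u j - u (j - 1))) = (\<Sum>j = 1..m. (u j - u (j - 1))\<^sup>2) + (u m)\<^sup>2" for m
    by (induction m) (simp_all add: assms(1) power2_eq_square algebra_simps)
  show ?thesis
  proof (cases p)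
    case 0
    then show ?thesis by (simp add: chain_form_def)
  next
    case (Suc m)
    with *[of m] assms(2) show ?thesis
      by (simp add: chain_form_def atLeastLessThanSuc_atLeastAtMost)
  qed
qed

lemma abs_diff_le_sum_squares:
  fixes u :: "nat \<Rightarrow> int"
  assumes "l \<le> k"
  shows "\<bar>u k - u l\<bar> \<le> (\<Sum>j = Suc l..k. (u j - u (j - 1))\<^sup>2)"
  using assms
proof (induction k rule: dec_induct)
  case (step k)
  have "\<bar>u (Suc k) - u k\<bar> \<le> (u (Suc k) - u k)\<^sup>2"
    using self_le_power[of "\<bar>u (Suc k) - u k\<bar>" 2] by (cases "u (Suc k) = u k") auto
  with step show ?case by simp
qed simp

text \<open>Walking from \<open>0\<close> to \<open>k\<close>, on to \<open>l\<close>, and back to \<open>0\<close> at the end \<open>p\<close>, each of the three parts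
  costs at least the change of \<open>u\<close>, because an integer is bounded by its square.\<close>

lemma chain_form_triangle:
  assumes "u 0 = 0" "u p = 0" "k \<le> l" "l \<le> p"
  shows "\<bar>u k\<bar> + \<bar>u l - u k\<bar> + \<bar>u l\<bar> \<le> 2 * chain_form p u"
proof -
  let ?D = "\<lambda>j. (u j - u (j - 1))\<^sup>2"
  have "(\<Sum>j = Suc 0..p. ?D j) = (\<Sum>j = Suc 0..k. ?D j) + (\<Sum>j = Suc k..l. ?D j) + (\<Sum>j = Suc l..p. ?D j)"
    using assms sum.ub_add_nat[of "Suc 0" k ?D "l - k"] sum.ub_add_nat[of "Suc 0" l ?D "p - l"] by simp
  then show ?thesis
    using abs_diff_le_sum_squares[of 0 k u] abs_diff_le_sum_squares[of k l u]
      abs_diff_le_sum_squares[of l p u] assms chain_form_eq_sum_squares[of u p] by simp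
qed

lemma chain_form_nonneg:
  assumes "u 0 = 0" "u p = 0"
  shows "chain_form p u \<ge> 0"
  using chain_form_triangle[of u p 0 0] assms by simp

lemma chain_form_pos:
  assumes "u 0 = 0" "u p = 0" "j \<le> p" "u j \<noteq> 0"
  shows "chain_form p u > 0"
  using chain_form_triangle[of u p j j] assms by simp

text \<open>The vectors of norm one are the roots of \<open>A\<^bsub>p-1\<^esub>\<close>, hence up to sign indicator functions of
  nonempty intervals.  The proof uses only that the values lie in \<open>{-1, 0, 1}\<close> and do not change
  sign, both of which are instances of \<open>chain_form_triangle\<close>.\<close>

lemma chain_form_one_sum:
  assumes "u 0 = 0" "u p = 0" "chain_form p u = 1"
  shows "(\<Sum>j = 1..<p. u j) \<noteq> 0" "\<bar>\<Sum>j = 1..<p. u j\<bar> < int p"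
proof -
  have "\<exists>j\<in>{1..<p}. u j \<noteq> 0"
  proof (rule ccontr)
    assume "\<not> (\<exists>j\<in>{1..<p}. u j \<noteq> 0)"
    then have "chain_form p u = 0" by (simp add: chain_form_def)
    with assms(3) show False by simp
  qed
  then obtain j0 where j0: "j0 \<in> {1..<p}" "u j0 \<noteq> 0" by blast
  have bound: "\<bar>u k\<bar> \<le> 1" if "k \<le> p" for k
    using chain_form_triangle[of u p k k] that assms by simp
  have same_sign: "u k * u l \<ge> 0" if "k \<le> p" "l \<le> p" for k l
  proof -
    have "\<bar>u k\<bar> + \<bar>u l - u k\<bar> + \<bar>u l\<bar> \<le> 2"
      using chain_form_triangle[of u p k l] chain_form_triangle[of u p l k] that assms
      by (cases "k \<le> l") auto
    moreover have "u k \<in> {-1, 0, 1}" "u l \<in> {-1, 0, 1}"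
      using bound[of k] bound[of l] that by auto
    ultimately show ?thesis by auto
  qed
  define s where "s = u j0"
  have s: "s = 1 \<or> s = -1" using bound[of j0] j0 by (auto simp: s_def)
  have v: "0 \<le> s * u j" "s * u j \<le> 1" if "j \<in> {1..<p}" for j
    using same_sign[of j0 j] bound[of j] j0 that s by (auto simp: s_def abs_le_iff)
  have "0 < (\<Sum>j = 1..<p. s * u j)"
    using j0 v s by (intro sum_pos2[of _ j0]) (auto simp: s_def)
  moreover have "(\<Sum>j = 1..<p. s * u j) \<le> (\<Sum>j = 1..<p. 1)"
    by (intro sum_mono v)
  moreover have "(\<Sum>j = 1..<p. s * u j) = s * (\<Sum>j = 1..<p. u j)"
    by (simp add: sum_distrib_left)
  ultimately show "(\<Sum>j = 1..<p. u j) \<noteq> 0" "\<bar>\<Sum>j = 1..<p. u j\<bar> < int p"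
    using s j0 by auto
qed

text \<open>Two summations by parts against the linear weight \<open>1 - j/p\<close>.  That weight is, up to scaling, the
  restriction of a radical vector to an arm of length \<open>p - 1\<close>.\<close>

lemma weighted_sum_differences:
  fixes x :: "nat \<Rightarrow> real"
  assumes "p \<ge> 1"
  shows "(\<Sum>j = 1..<p. (1 - real j / real p) * (x j - x (j - 1))) =
    (\<Sum>j = 1..<p. x j) / real p - (1 - 1 / real p) * x 0"
proof -
  have *: "(\<Sum>j = 1..m. (r - real j) * (x j - x (j - 1))) =
      (\<Sum>j = 1..m. x j) + (r - real m - 1) * x m - (r - 1) * x 0" for m r
    by (induction m) (simp_all add: algebra_simps)
  obtain m where m: "p = Suc m" using assms by (cases p) auto
  have "(\<Sum>j = 1..<p. (1 - real j / real p) * (x j - x (j - 1))) =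
      (\<Sum>j = 1..m. (real p - real j) * (x j - x (j - 1))) / real p"
    unfolding m atLeastLessThanSuc_atLeastAtMost sum_divide_distrib
    by (intro sum.cong refl) (simp add: field_simps)
  also have "\<dots> = ((\<Sum>j = 1..m. x j) - (real p - 1) * x 0) / real p"
    unfolding * by (simp add: m)
  also have "\<dots> = (\<Sum>j = 1..m. x j) / real p - (1 - 1 / real p) * x 0"
    using assms by (simp add: field_simps)
  finally show ?thesis
    unfolding m atLeastLessThanSuc_atLeastAtMost .
qed

lemma weighted_sum_second_differences:
  fixes x :: "nat \<Rightarrow> real"
  assumes "p \<ge> 1" "x p = 0"
  shows "(\<Sum>j = 1..<p. (1 - real j / real p) * (2 * x j - x (j - 1) - x (Suc j))) =
    x 1 - (1 - 1 / real p) * x 0"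
proof -
  have *: "(\<Sum>j = 1..m. (r - real j) * (2 * x j - x (j - 1) - x (Suc j))) =
      r * x 1 - (r - 1) * x 0 - (r - real m) * x (Suc m) + (r - real m - 1) * x m" for m r
    by (induction m) (simp_all add: algebra_simps)
  obtain m where m: "p = Suc m" using assms by (cases p) auto
  have "(\<Sum>j = 1..<p. (1 - real j / real p) * (2 * x j - x (j - 1) - x (Suc j))) =
      (\<Sum>j = 1..m. (real p - real j) * (2 * x j - x (j - 1) - x (Suc j))) / real p"
    unfolding m atLeastLessThanSuc_atLeastAtMost sum_divide_distrib
    by (intro sum.cong refl) (simp add: field_simps)
  also have "\<dots> = (real p * x 1 - (real p - 1) * x 0) / real p"
    unfolding * using assms(2) by (simp add: m)
  finally show ?thesis
    using assms(1) by (simp add: field_simps)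
qed

section \<open>Homogeneous linear systems over the integers\<close>

text \<open>Padding the system with zero equations makes it square with vanishing determinant.\<close>

lemma homogeneous_system:
  fixes a :: "nat \<Rightarrow> nat \<Rightarrow> int"
  assumes "m < n"
  obtains x where "\<exists>j<n. x j \<noteq> 0" "\<And>i. i < m \<Longrightarrow> (\<Sum>j = 0..<n. a i j * x j) = 0"
proof -
  define A where "A = mat n n (\<lambda>(i, j). if i < m then a i j else 0)"
  have A: "A \<in> carrier_mat n n" by (simp add: A_def)
  (* Row m of A vanishes, so the transpose has a unit vector in its kernel. *)
  have "A\<^sup>T *\<^sub>v unit_vec n m = 0\<^sub>v n"
    using assms by (intro eq_vecI) (simp_all add: A_def)
  moreover have "unit_vec n m \<noteq> (0\<^sub>v n :: int vec)"
    using assms by (metis index_unit_vec(1) index_zero_vec(1) zero_neq_one)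
  ultimately have "det A\<^sup>T = 0"
    using det_0_iff_vec_prod_zero[of "A\<^sup>T" n] A by (auto intro: exI[of _ "unit_vec n m"])
  then have "det A = 0" by (simp add: det_transpose[OF A])
  then obtain x where x: "x \<in> carrier_vec n" "x \<noteq> 0\<^sub>v n" "A *\<^sub>v x = 0\<^sub>v n"
    using det_0_iff_vec_prod_zero[OF A] by blast
  show thesis
  proof (rule that[of "($) x"])
    show "\<exists>j<n. x $ j \<noteq> 0" using x(1,2) by (metis carrier_vecD eq_vecI index_zero_vec)
    fix i assume i: "i < m"
    then have "(A *\<^sub>v x) $ i = (\<Sum>j = 0..<n. a i j * x $ j)"
      using assms x(1) by (simp add: A_def scalar_prod_def)
    then show "(\<Sum>j = 0..<n. a i j * x $ j) = 0" using x(3) i assms by simp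
  qed
qed

section \<open>The bilinear form in coordinates\<close>

lemma sum_basis:
  "(\<Sum>v\<in>set (basis \<sigma>). g v) =
     (\<Sum>i = 1..arms \<sigma>. \<Sum>j = 1..<wt \<sigma> i. g (Arm i j)) + (g Zero + g ZeroStar)"
proof -
  let ?A = "SIGMA i:{1..arms \<sigma>}. {1..<wt \<sigma> i}"
  have "set (basis \<sigma>) = (\<lambda>(i, j). Arm i j) ` ?A \<union> {Zero, ZeroStar}"
    unfolding set_basis by force
  moreover have "(\<Sum>v\<in>(\<lambda>(i, j). Arm i j) ` ?A. g v) = (\<Sum>i = 1..arms \<sigma>. \<Sum>j = 1..<wt \<sigma> i. g (Arm i j))"
    by (subst sum.reindex) (auto simp: inj_on_def sum.Sigma intro!: sum.cong)
  ultimately have "(\<Sum>v\<in>set (basis \<sigma>). g v) =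
      (\<Sum>i = 1..arms \<sigma>. \<Sum>j = 1..<wt \<sigma> i. g (Arm i j)) + (\<Sum>v\<in>{Zero, ZeroStar}. g v)"
    by (simp only:) (subst sum.union_disjoint, auto)
  then show ?thesis by simp
qed

lemma Kform_frag_of_left:
  "v \<in> set (basis \<sigma>) \<Longrightarrow> Kform \<sigma> \<kappa> (frag_of v) y =
     (\<Sum>b\<in>set (basis \<sigma>). Poly_Mapping.lookup y b * gram \<sigma> \<kappa> v b)"
  unfolding Kform_def lookup_frag_of
  by (subst sum.remove[of _ v]) (auto intro!: sum.neutral)

lemma Kform_frag_of_right:
  "v \<in> set (basis \<sigma>) \<Longrightarrow> Kform \<sigma> \<kappa> y (frag_of v) =
     (\<Sum>a\<in>set (basis \<sigma>). Poly_Mapping.lookup y a * gram \<sigma> \<kappa> a v)"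
  unfolding Kform_def lookup_frag_of
  by (intro sum.cong refl, subst sum.remove[of _ v]) (auto intro!: sum.neutral)

lemma Kform_expand_left:
  "Kform \<sigma> \<kappa> x y = (\<Sum>a\<in>set (basis \<sigma>). Poly_Mapping.lookup x a * Kform \<sigma> \<kappa> (frag_of a) y)"
  unfolding Kform_def[of \<sigma> \<kappa> x y]
  by (intro sum.cong refl) (simp add: Kform_frag_of_left sum_distrib_left mult.assoc)

locale canonical_lattice =
  fixes \<sigma> :: symbol and \<kappa> :: nat
  assumes symbol: "is_symbol \<sigma>" and admissible: "admissible \<sigma> \<kappa>"
begin

abbreviation "V \<equiv> set (basis \<sigma>)"
abbreviation "L \<equiv> carrier (lattice \<sigma>)"
abbreviation "K \<equiv> Kform \<sigma> \<kappa>"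
abbreviation "B \<equiv> Bform \<sigma> \<kappa>"
abbreviation "G \<equiv> isometry_group \<sigma> \<kappa>"
abbreviation "\<epsilon> \<equiv> int (eps \<sigma>)"
abbreviation "e i \<equiv> int (ee \<sigma> i)"
abbreviation "f i \<equiv> int (ff \<sigma> i)"
abbreviation "coord x v \<equiv> Poly_Mapping.lookup x v"

text \<open>The norm \<open>K \<alpha> \<alpha>\<close> of the basis elements on the \<open>i\<close>-th arm.\<close>

definition q :: "nat \<Rightarrow> int" where
  "q i = int (\<kappa> * eps \<sigma> * ff \<sigma> i div ee \<sigma> i)"

text \<open>Up to a nonzero factor, this is pairing under \<open>K\<close> with the radical vector
  \<open>\<alpha>\<^bsub>0*\<^esub> - \<epsilon> \<alpha>\<^sub>0\<close>; it corresponds to the rank of coherent sheaves.\<close>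

definition rk :: "(vertex \<Rightarrow>\<^sub>0 int) \<Rightarrow> int" where
  "rk x = coord x Zero + \<epsilon> * coord x ZeroStar"

text \<open>The value at \<open>j = 0\<close> is chosen so that the basis element next to the centre obeys the same
  formulas for \<open>K\<close> and \<open>B\<close> as the others; this works because \<open>q i * e i = \<kappa> \<epsilon> f\<^sub>i\<close>.\<close>

definition arm_coord :: "(vertex \<Rightarrow>\<^sub>0 int) \<Rightarrow> nat \<Rightarrow> nat \<Rightarrow> int" where
  "arm_coord x i j = (if j = 0 then e i * rk x else coord x (Arm i j))"

lemma kappa_pos: "\<kappa> \<ge> 1" and eps_cases: "eps \<sigma> = 1 \<or> eps \<sigma> = 2"
  using symbol admissible by (auto simp: is_symbol_def admissible_def)

lemma arm_facts:
  assumes "i \<in> {1..arms \<sigma>}"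
  shows "wt \<sigma> i \<ge> 2" "ff \<sigma> i \<ge> 1" "ee \<sigma> i \<ge> 1" "ee \<sigma> i * ff \<sigma> i = dd \<sigma> i"
    "q i * e i = int \<kappa> * \<epsilon> * f i" "q i > 0"
proof -
  have *: "wt \<sigma> i \<ge> 2" "ff \<sigma> i \<ge> 1" "dd \<sigma> i \<ge> 1" "ff \<sigma> i dvd dd \<sigma> i"
    using symbol assms by (auto simp: is_symbol_def)
  then show "wt \<sigma> i \<ge> 2" "ff \<sigma> i \<ge> 1" by simp_all
  show ed: "ee \<sigma> i * ff \<sigma> i = dd \<sigma> i" using * by (simp add: ee_def)
  then show e1: "ee \<sigma> i \<ge> 1" using * by (cases "ee \<sigma> i") auto
  have "ee \<sigma> i dvd \<kappa> * eps \<sigma> * ff \<sigma> i"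
    using admissible assms by (simp add: admissible_def)
  then have "\<kappa> * eps \<sigma> * ff \<sigma> i div ee \<sigma> i * ee \<sigma> i = \<kappa> * eps \<sigma> * ff \<sigma> i" by simp
  then show qe: "q i * e i = int \<kappa> * \<epsilon> * f i"
    unfolding q_def by (metis of_nat_mult)
  have "q i * e i > 0" unfolding qe using kappa_pos eps_cases * by auto
  then show "q i > 0" using e1 by (simp add: zero_less_mult_iff)
qed

lemma gram_ZeroStar: "gram \<sigma> \<kappa> (Arm i j) ZeroStar = \<epsilon> * gram \<sigma> \<kappa> (Arm i j) Zero"
  by (simp add: power2_eq_square)

lemma special_vertices: "Zero \<in> V" "ZeroStar \<in> V"
  by (simp_all add: set_basis)

lemma lookup_outside: "x \<in> L \<Longrightarrow> v \<notin> V \<Longrightarrow> coord x v = 0"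
  by (auto simp: carrier_lattice in_keys_iff)

lemma arm_coord_end: "x \<in> L \<Longrightarrow> i \<in> {1..arms \<sigma>} \<Longrightarrow> arm_coord x i (wt \<sigma> i) = 0"
  using arm_facts(1)[of i] by (auto simp: arm_coord_def set_basis intro: lookup_outside)

text \<open>Thus \<open>K\<close> takes first differences along an arm, and \<open>B\<close> takes second differences.\<close>

lemma K_Arm_left:
  assumes "Arm i j \<in> V"
  shows "K (frag_of (Arm i j)) y = q i * (arm_coord y i j - arm_coord y i (j - 1))"
proof -
  from assms have ij: "i \<in> {1..arms \<sigma>}" "j \<ge> 1" "j < wt \<sigma> i" by (auto simp: set_basis)
  then have prev: "j \<noteq> 1 \<Longrightarrow> Arm i (j - 1) \<in> V" by (auto simp: set_basis)
  have "coord y v * gram \<sigma> \<kappa> (Arm i j) v = (if v = Arm i j then q i * coord y v else 0)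
      + (if v = Arm i (j - 1) then - q i * (if j = 1 then 0 else coord y v) else 0)
      + (if v = Zero then - q i * (if j = 1 then e i * coord y v else 0) else 0)
      + (if v = ZeroStar then - q i * (if j = 1 then e i * \<epsilon> * coord y v else 0) else 0)" if "v \<in> V" for v
    using ij that arm_facts(5)[OF ij(1)]
    by (cases v) (auto simp: q_def power2_eq_square algebra_simps set_basis)
  then have "K (frag_of (Arm i j)) y = (\<Sum>v\<in>V. (if v = Arm i j then q i * coord y v else 0)
      + (if v = Arm i (j - 1) then - q i * (if j = 1 then 0 else coord y v) else 0)
      + (if v = Zero then - q i * (if j = 1 then e i * coord y v else 0) else 0)
      + (if v = ZeroStar then - q i * (if j = 1 then e i * \<epsilon> * coord y v else 0) else 0))"
    by (simp add: Kform_frag_of_left assms cong: sum.cong)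
  also have "\<dots> = q i * (arm_coord y i j - arm_coord y i (j - 1))"
    using ij assms prev special_vertices unfolding sum.distrib
    by (cases "j = 1") (simp_all add: arm_coord_def rk_def algebra_simps)
  finally show ?thesis .
qed

lemma K_Zero_left: "K (frag_of Zero) y = int \<kappa> * (coord y Zero + 2 * \<epsilon> * coord y ZeroStar)"
  by (simp add: Kform_frag_of_left special_vertices sum_basis algebra_simps)

lemma K_ZeroStar_left: "K (frag_of ZeroStar) y = int \<kappa> * \<epsilon>\<^sup>2 * coord y ZeroStar"
  by (simp add: Kform_frag_of_left special_vertices sum_basis algebra_simps)

lemma B_Arm:
  assumes "Arm i j \<in> V" "y \<in> L"
  shows "B y (frag_of (Arm i j)) =
    q i * (2 * arm_coord y i j - arm_coord y i (j - 1) - arm_coord y i (Suc j))"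
proof -
  from assms have ij: "i \<in> {1..arms \<sigma>}" "j \<ge> 1" "j < wt \<sigma> i" by (auto simp: set_basis)
  have "coord y v * gram \<sigma> \<kappa> v (Arm i j) = (if v = Arm i j then q i * coord y v else 0)
      + (if v = Arm i (Suc j) then - q i * coord y v else 0)" for v
    by (cases v) (auto simp: q_def)
  then have "K y (frag_of (Arm i j)) = (\<Sum>v\<in>V. (if v = Arm i j then q i * coord y v else 0)
      + (if v = Arm i (Suc j) then - q i * coord y v else 0))"
    by (simp add: Kform_frag_of_right assms cong: sum.cong)
  also have "\<dots> = q i * (arm_coord y i j - arm_coord y i (Suc j))"
    using ij assms lookup_outside[OF assms(2), of "Arm i (Suc j)"] unfolding sum.distrib
    by (auto simp: arm_coord_def algebra_simps)
  finally show ?thesis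
    by (simp add: Bform_def K_Arm_left assms algebra_simps)
qed

text \<open>The second identity expresses that \<open>\<alpha>\<^bsub>0*\<^esub> - \<epsilon> \<alpha>\<^sub>0\<close> lies in the radical of \<open>B\<close>.\<close>

lemma B_Zero:
  assumes "y \<in> L"
  shows "B y (frag_of Zero) = 2 * int \<kappa> * rk y - (\<Sum>i = 1..arms \<sigma>. q i * e i * arm_coord y i 1)"
    and "B y (frag_of ZeroStar) = \<epsilon> * B y (frag_of Zero)"
proof -
  have arm: "(\<Sum>j = 1..<wt \<sigma> i. coord y (Arm i j) * gram \<sigma> \<kappa> (Arm i j) Zero)
      = - (q i * e i * arm_coord y i 1)" if "i \<in> {1..arms \<sigma>}" for i
  proof -
    have "(\<Sum>j = 1..<wt \<sigma> i. coord y (Arm i j) * gram \<sigma> \<kappa> (Arm i j) Zero)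
        = (\<Sum>j = 1..<wt \<sigma> i. if j = 1 then - (q i * e i * arm_coord y i 1) else 0)"
      by (intro sum.cong refl) (simp add: arm_facts(5)[OF that] arm_coord_def)
    then show ?thesis using arm_facts(1)[OF that] by simp
  qed
  have "K y (frag_of Zero) = (\<Sum>i = 1..arms \<sigma>. - (q i * e i * arm_coord y i 1)) + int \<kappa> * coord y Zero"
    by (simp only: Kform_frag_of_right special_vertices sum_basis arm cong: sum.cong) simp
  then show *: "B y (frag_of Zero) = 2 * int \<kappa> * rk y - (\<Sum>i = 1..arms \<sigma>. q i * e i * arm_coord y i 1)"
    by (simp add: Bform_def K_Zero_left rk_def sum_negf algebra_simps)
  have "K y (frag_of ZeroStar) = \<epsilon> * (\<Sum>i = 1..arms \<sigma>. - (q i * e i * arm_coord y i 1))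
      + 2 * int \<kappa> * \<epsilon> * coord y Zero + int \<kappa> * \<epsilon>\<^sup>2 * coord y ZeroStar"
  proof -
    have "(\<Sum>i = 1..arms \<sigma>. \<Sum>j = 1..<wt \<sigma> i. coord y (Arm i j) * gram \<sigma> \<kappa> (Arm i j) ZeroStar)
        = \<epsilon> * (\<Sum>i = 1..arms \<sigma>. - (q i * e i * arm_coord y i 1))"
      unfolding sum_distrib_left
      by (intro sum.cong refl, subst arm[symmetric], simp)
         (simp add: gram_ZeroStar sum_distrib_left algebra_simps del: gram.simps)
    then show ?thesis
      by (simp only: Kform_frag_of_right special_vertices sum_basis) simp
  qed
  then show "B y (frag_of ZeroStar) = \<epsilon> * B y (frag_of Zero)"
    unfolding * by (simp add: Bform_def K_ZeroStar_left rk_def sum_negf power2_eq_square algebra_simps)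
qed

lemma K_self:
  assumes "rk x = 0"
  shows "K x x = (\<Sum>i = 1..arms \<sigma>. q i * chain_form (wt \<sigma> i) (arm_coord x i))"
proof -
  have "(\<Sum>j = 1..<wt \<sigma> i. coord x (Arm i j) * K (frag_of (Arm i j)) x)
      = q i * chain_form (wt \<sigma> i) (arm_coord x i)" if i: "i \<in> {1..arms \<sigma>}" for i
    unfolding chain_form_def sum_distrib_left
    using i by (intro sum.cong refl) (auto simp: K_Arm_left set_basis arm_coord_def)
  moreover have "coord x Zero * K (frag_of Zero) x + coord x ZeroStar * K (frag_of ZeroStar) x = int \<kappa> * (rk x)\<^sup>2"
    by (simp add: K_Zero_left K_ZeroStar_left rk_def power2_eq_square algebra_simps)
  ultimately show ?thesis
    using assms by (subst Kform_expand_left) (simp add: sum_basis)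
qed

section \<open>Roots\<close>

abbreviation s :: "vertex \<Rightarrow> (vertex \<Rightarrow>\<^sub>0 int) \<Rightarrow> (vertex \<Rightarrow>\<^sub>0 int)" where
  "s v \<equiv> reflection \<sigma> \<kappa> (frag_of v)"

definition cartan :: "(vertex \<Rightarrow>\<^sub>0 int) \<Rightarrow> vertex \<Rightarrow> int" where
  "cartan y v = 2 * B y (frag_of v) div B (frag_of v) (frag_of v)"

text \<open>The real roots, as the orbit of the basis under words in the simple reflections; this form
  allows the invariants of roots to be proved by induction.\<close>

inductive_set roots :: "(vertex \<Rightarrow>\<^sub>0 int) set" where
  simple: "v \<in> V \<Longrightarrow> frag_of v \<in> roots"
| reflect: "\<beta> \<in> roots \<Longrightarrow> v \<in> V \<Longrightarrow> s v \<beta> \<in> roots"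

lemma frag_of_in_L: "v \<in> V \<Longrightarrow> frag_of v \<in> L"
  by (simp add: carrier_lattice)

lemma B_simple: "v \<in> V \<Longrightarrow> B (frag_of v) (frag_of v) = 2 * gram \<sigma> \<kappa> v v"
  by (simp add: Bform_def Kform_basis)

lemma gram_pos: "v \<in> V \<Longrightarrow> gram \<sigma> \<kappa> v v > 0"
  using Bform_basis_pos[OF symbol admissible, of v] B_simple[of v] by simp

lemma B_self: "B x x = 2 * K x x"
  by (simp add: Bform_def)

lemma cartan_mult:
  assumes "v \<in> V" "y \<in> L"
  shows "cartan y v * gram \<sigma> \<kappa> v v = B y (frag_of v)"
  using reflection_exact[OF symbol admissible assms] B_simple[OF assms(1)]
  by (simp add: cartan_def)

lemma s_apply: "y \<in> L \<Longrightarrow> s v y = y - frag_cmul (cartan y v) (frag_of v)"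
  by (simp add: reflection_def cartan_def)

lemma s_in_G: "v \<in> V \<Longrightarrow> s v \<in> carrier G"
  by (rule reflection_in_isometry_group[OF symbol admissible])

lemma G_D:
  assumes "\<phi> \<in> carrier G"
  shows "\<phi> \<in> Bij L" "x \<in> L \<Longrightarrow> \<phi> x \<in> L" "x \<in> L \<Longrightarrow> y \<in> L \<Longrightarrow> \<phi> (x + y) = \<phi> x + \<phi> y"
    "x \<in> L \<Longrightarrow> y \<in> L \<Longrightarrow> B (\<phi> x) (\<phi> y) = B x y"
proof -
  have hom: "\<phi> \<in> hom (lattice \<sigma>) (lattice \<sigma>)" and bij: "\<phi> \<in> Bij L"
    using assms by (simp_all add: isometry_group_def auto_def)
  show "\<phi> \<in> Bij L" by (rule bij)
  show "x \<in> L \<Longrightarrow> \<phi> x \<in> L" by (rule hom_in_carrier[OF hom])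
  show "x \<in> L \<Longrightarrow> y \<in> L \<Longrightarrow> \<phi> (x + y) = \<phi> x + \<phi> y"
    using hom_mult[OF hom, of x y] by (simp add: lattice_def)
  show "x \<in> L \<Longrightarrow> y \<in> L \<Longrightarrow> B (\<phi> x) (\<phi> y) = B x y"
    using assms by (simp add: isometry_group_def)
qed

lemma s_in_L: "v \<in> V \<Longrightarrow> y \<in> L \<Longrightarrow> s v y \<in> L"
  using G_D(2)[OF s_in_G] .

lemma lookup_s:
  assumes "y \<in> L"
  shows "coord (s v y) u = coord y u - (if u = v then cartan y v else 0)"
  using assms by (simp add: s_apply lookup_minus)

lemma s_involutive:
  assumes v: "v \<in> V" and y: "y \<in> L"
  shows "s v (s v y) = y"
proof -
  have "cartan (s v y) v * gram \<sigma> \<kappa> v v = - cartan y v * gram \<sigma> \<kappa> v v"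
    using cartan_mult[OF v y] cartan_mult[OF v s_in_L[OF v y]] B_simple[OF v]
    by (simp add: s_apply[OF y] Bform_diff Bform_cmul)
  then have "cartan (s v y) v = - cartan y v"
    using gram_pos[OF v] mult_cancel_right by (metis less_irrefl)
  then show ?thesis
    by (intro poly_mapping_eqI) (simp add: lookup_s s_in_L v y)
qed

lemma B_s_swap:
  assumes "v \<in> V" "x \<in> L" "y \<in> L"
  shows "B (s v x) y = B x (s v y)"
  using G_D(4)[OF s_in_G, of v x "s v y"] assms by (simp add: s_involutive s_in_L)

lemma roots_subset: "\<beta> \<in> roots \<Longrightarrow> \<beta> \<in> L"
  by (induction rule: roots.induct) (simp_all add: frag_of_in_L s_in_L)

lemma K_s: "v \<in> V \<Longrightarrow> \<beta> \<in> L \<Longrightarrow> K (s v \<beta>) (s v \<beta>) = K \<beta> \<beta>"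
  using G_D(4)[OF s_in_G, of v \<beta> \<beta>] by (simp add: B_self)

lemma root_norm_pos: "\<beta> \<in> roots \<Longrightarrow> K \<beta> \<beta> > 0"
  by (induction rule: roots.induct) (simp_all add: K_s roots_subset Kform_basis gram_pos)

text \<open>Integrality of \<open>2 B(\<beta>, y) / B(\<beta>, \<beta>)\<close> passes from simple roots to all roots because simple
  reflections are isometries.\<close>

lemma root_norm_dvd_B:
  assumes "\<beta> \<in> roots" "y \<in> L"
  shows "K \<beta> \<beta> dvd B \<beta> y"
  using assms
proof (induction arbitrary: y rule: roots.induct)
  case (simple v)
  then show ?case
    using cartan_mult[of v y] by (metis Bform_sym Kform_basis dvd_triv_right)
next
  case (reflect \<beta> v)
  then show ?case by (simp add: K_s roots_subset B_s_swap s_in_L)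
qed

text \<open>The coroot \<open>\<beta> / K \<beta> \<beta>\<close> is an integral combination of the simple coroots
  \<open>\<alpha> / K \<alpha> \<alpha>\<close>.\<close>

lemma root_norm_dvd_coord:
  assumes "\<beta> \<in> roots" "u \<in> V"
  shows "K \<beta> \<beta> dvd gram \<sigma> \<kappa> u u * coord \<beta> u"
  using assms
proof (induction rule: roots.induct)
  case (simple v)
  then show ?case by (simp add: Kform_basis)
next
  case (reflect \<beta> v)
  then have "gram \<sigma> \<kappa> u u * coord (s v \<beta>) u = gram \<sigma> \<kappa> u u * coord \<beta> u - (if u = v then B \<beta> (frag_of v) else 0)"
    using cartan_mult[of v \<beta>] by (simp add: lookup_s roots_subset algebra_simps)
  then show ?case
    using reflect root_norm_dvd_B[OF reflect(1) frag_of_in_L[OF reflect(2)]]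
    by (simp add: K_s roots_subset dvd_diff)
qed

section \<open>Tubular type: the radical\<close>

text \<open>The coordinates of a second radical vector of \<open>B\<close>, independent of \<open>\<alpha>\<^bsub>0*\<^esub> - \<epsilon> \<alpha>\<^sub>0\<close>.  They are in
  general not integral, so they are kept as real weights on the basis instead of as an element of the
  lattice.\<close>

fun radical_weight :: "vertex \<Rightarrow> real" where
  "radical_weight (Arm i j) = e i * (1 - real j / real (wt \<sigma> i))"
| "radical_weight Zero = 1"
| "radical_weight ZeroStar = 0"

text \<open>Each arm contributes its neighbour of the centre minus a multiple of \<open>rk y\<close>; the former cancel
  against \<open>B_Zero\<close>, and the latter add up to zero exactly by the tubular equation.\<close>

lemma sum_radical_weight_B:
  assumes tub: "tubular \<sigma>" and y: "y \<in> L"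
  shows "(\<Sum>v\<in>V. radical_weight v * B y (frag_of v)) = 0"
proof -
  have arm: "(\<Sum>j = 1..<wt \<sigma> i. radical_weight (Arm i j) * B y (frag_of (Arm i j))) =
      q i * e i * arm_coord y i 1 - rk y * \<kappa> * (eps \<sigma> * real (dd \<sigma> i) * (1 - 1 / wt \<sigma> i))"
    if i: "i \<in> {1..arms \<sigma>}" for i
  proof -
    have "(\<Sum>j = 1..<wt \<sigma> i. radical_weight (Arm i j) * B y (frag_of (Arm i j))) =
        (\<Sum>j = 1..<wt \<sigma> i. q i * e i * ((1 - real j / real (wt \<sigma> i)) *
           (2 * real_of_int (arm_coord y i j) - arm_coord y i (j - 1) - arm_coord y i (Suc j))))"
      using i y by (intro sum.cong refl) (simp add: B_Arm set_basis)
    also have "\<dots> = q i * e i * (arm_coord y i 1 - (1 - 1 / real (wt \<sigma> i)) * arm_coord y i 0)"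
      unfolding sum_distrib_left[symmetric]
      using arm_facts(1)[OF i] arm_coord_end[OF y i]
      by (subst weighted_sum_second_differences) simp_all
    also have "\<dots> = q i * e i * arm_coord y i 1 - (q i * e i) * (e i * rk y) * (1 - 1 / real (wt \<sigma> i))"
      by (simp add: arm_coord_def algebra_simps)
    also have "(q i * e i) * (e i * rk y) = int (\<kappa> * eps \<sigma>) * int (ee \<sigma> i * ff \<sigma> i) * rk y"
      by (simp add: arm_facts(5)[OF i])
    finally show ?thesis
      by (simp add: arm_facts(4)[OF i] mult_ac)
  qed
  have "(\<Sum>v\<in>V. radical_weight v * B y (frag_of v)) =
      (\<Sum>i = 1..arms \<sigma>. q i * e i * arm_coord y i 1 - rk y * \<kappa> * (eps \<sigma> * real (dd \<sigma> i) * (1 - 1 / wt \<sigma> i)))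
      + B y (frag_of Zero)"
    by (simp only: sum_basis arm cong: sum.cong) simp
  also have "\<dots> = 2 * \<kappa> * rk y - rk y * \<kappa> * (\<Sum>i = 1..arms \<sigma>. eps \<sigma> * real (dd \<sigma> i) * (1 - 1 / wt \<sigma> i))"
    unfolding sum_subtractf sum_distrib_left[symmetric] by (simp add: B_Zero(1)[OF y])
  also have "\<dots> = 0"
    using tub by (simp add: tubular_def)
  finally show ?thesis .
qed

text \<open>Pairing with the second radical vector is the degree, on classes of rank zero.\<close>

lemma sum_radical_weight_K:
  assumes "rk y = 0"
  shows "(\<Sum>v\<in>V. radical_weight v * K (frag_of v) y) =
    real \<kappa> * eps \<sigma> * ((\<Sum>i = 1..arms \<sigma>. ff \<sigma> i * (\<Sum>j = 1..<wt \<sigma> i. arm_coord y i j) / wt \<sigma> i) + coord y ZeroStar)"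
proof -
  have arm: "(\<Sum>j = 1..<wt \<sigma> i. radical_weight (Arm i j) * K (frag_of (Arm i j)) y) =
      real \<kappa> * eps \<sigma> * (ff \<sigma> i * (\<Sum>j = 1..<wt \<sigma> i. arm_coord y i j) / wt \<sigma> i)"
    if i: "i \<in> {1..arms \<sigma>}" for i
  proof -
    have "(\<Sum>j = 1..<wt \<sigma> i. radical_weight (Arm i j) * K (frag_of (Arm i j)) y) =
        (\<Sum>j = 1..<wt \<sigma> i. q i * e i * ((1 - real j / real (wt \<sigma> i)) *
           (real_of_int (arm_coord y i j) - arm_coord y i (j - 1))))"
      using i by (intro sum.cong refl) (simp add: K_Arm_left set_basis)
    also have "\<dots> = (q i * e i) * ((\<Sum>j = 1..<wt \<sigma> i. real_of_int (arm_coord y i j)) / real (wt \<sigma> i))"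
      unfolding sum_distrib_left[symmetric]
      using arm_facts(1)[OF i] assms
      by (subst weighted_sum_differences) (simp_all add: arm_coord_def)
    finally show ?thesis
      unfolding arm_facts(5)[OF i] by simp
  qed
  have a: "coord y Zero = - \<epsilon> * coord y ZeroStar" using assms by (simp add: rk_def)
  have "(\<Sum>v\<in>V. radical_weight v * K (frag_of v) y) =
      (\<Sum>i = 1..arms \<sigma>. real \<kappa> * eps \<sigma> * (ff \<sigma> i * (\<Sum>j = 1..<wt \<sigma> i. arm_coord y i j) / wt \<sigma> i)) + K (frag_of Zero) y"
    by (simp only: sum_basis arm cong: sum.cong) simp
  then show ?thesis
    unfolding K_Zero_left a sum_distrib_left[symmetric] by (simp add: algebra_simps)
qed

section \<open>No root is orthogonal to the radical\<close>

text \<open>Left orthogonality under \<open>K\<close> to both radical vectors.\<close>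

definition radical_orth :: "(vertex \<Rightarrow>\<^sub>0 int) \<Rightarrow> bool" where
  "radical_orth x \<longleftrightarrow> K (frag_of ZeroStar) x = \<epsilon> * K (frag_of Zero) x \<and>
     (\<Sum>v\<in>V. radical_weight v * K (frag_of v) x) = 0"

lemma radical_orth_coords:
  assumes "radical_orth x"
  shows "rk x = 0"
    "(\<Sum>i = 1..arms \<sigma>. ff \<sigma> i * (\<Sum>j = 1..<wt \<sigma> i. arm_coord x i j) / wt \<sigma> i) = - real_of_int (coord x ZeroStar)"
proof -
  have "int \<kappa> * \<epsilon> * rk x = 0"
    using assms by (simp add: radical_orth_def K_Zero_left K_ZeroStar_left rk_def power2_eq_square algebra_simps)
  then show rk: "rk x = 0" using kappa_pos eps_cases by auto
  have "real \<kappa> * eps \<sigma> \<noteq> 0" using kappa_pos eps_cases by auto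
  then show "(\<Sum>i = 1..arms \<sigma>. ff \<sigma> i * (\<Sum>j = 1..<wt \<sigma> i. arm_coord x i j) / wt \<sigma> i) = - real_of_int (coord x ZeroStar)"
    using assms sum_radical_weight_K[OF rk] by (auto simp: radical_orth_def)
qed

text \<open>Let \<open>Q = K \<beta> \<beta>\<close>, which is the sum of \<open>q i * N i\<close> with \<open>N i\<close> the chain form of the \<open>i\<close>-th arm.  By
  integrality of the coroot, \<open>Q\<close> divides the coordinates on the arm after scaling by \<open>q i\<close>, so on an arm
  where \<open>\<beta>\<close> does not vanish \<open>Q\<^sup>2 \<le> (q i)\<^sup>2 * N i\<close>.  Together with \<open>q i * N i \<le> Q\<close> this forces \<open>N i = 1\<close>
  and \<open>Q = q i\<close>, and leaves nothing for the other arms.\<close>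

lemma root_on_one_arm:
  assumes root: "\<beta> \<in> roots" and rk: "rk \<beta> = 0"
  obtains i where "i \<in> {1..arms \<sigma>}" "K \<beta> \<beta> = q i" "chain_form (wt \<sigma> i) (arm_coord \<beta> i) = 1"
    "\<And>k j. k \<in> {1..arms \<sigma>} \<Longrightarrow> k \<noteq> i \<Longrightarrow> j < wt \<sigma> k \<Longrightarrow> arm_coord \<beta> k j = 0"
proof -
  define Q where "Q = K \<beta> \<beta>"
  define N where "N i = chain_form (wt \<sigma> i) (arm_coord \<beta> i)" for i
  have \<beta>L: "\<beta> \<in> L" using roots_subset[OF root] .
  have Q: "Q = (\<Sum>i = 1..arms \<sigma>. q i * N i)" and Qpos: "Q > 0"
    using K_self[OF rk] root_norm_pos[OF root] by (simp_all add: Q_def N_def)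
  have ends: "arm_coord \<beta> i 0 = 0" "i \<in> {1..arms \<sigma>} \<Longrightarrow> arm_coord \<beta> i (wt \<sigma> i) = 0" for i
    using rk arm_coord_end[OF \<beta>L] by (simp_all add: arm_coord_def)
  have N0: "N i \<ge> 0" if "i \<in> {1..arms \<sigma>}" for i
    unfolding N_def using chain_form_nonneg[of "arm_coord \<beta> i" "wt \<sigma> i"] ends that by blast
  have "\<exists>i\<in>{1..arms \<sigma>}. N i \<noteq> 0"
  proof (rule ccontr)
    assume "\<not> (\<exists>i\<in>{1..arms \<sigma>}. N i \<noteq> 0)"
    then have "Q = 0" unfolding Q by (intro sum.neutral) auto
    with Qpos show False by simp
  qed
  then obtain i where i: "i \<in> {1..arms \<sigma>}" and Ni: "N i > 0" using N0 by force
  note qi = arm_facts(6)[OF i]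
  have dvd: "Q dvd q i * arm_coord \<beta> i j" for j
  proof (cases "Arm i j \<in> V")
    case True
    then have "j \<noteq> 0" by (auto simp: set_basis)
    then show ?thesis using root_norm_dvd_coord[OF root True] by (simp add: Q_def q_def arm_coord_def)
  next
    case False
    then show ?thesis using lookup_outside[OF \<beta>L] by (cases "j = 0") (auto simp: arm_coord_def rk)
  qed
  define z where "z j = q i * arm_coord \<beta> i j div Q" for j
  have z: "q i * arm_coord \<beta> i j = Q * z j" for j using dvd[of j] by (simp add: z_def)
  have "(q i)\<^sup>2 * N i = chain_form (wt \<sigma> i) (\<lambda>j. q i * arm_coord \<beta> i j)"
    by (simp add: N_def chain_form_scale)
  then have sq: "(q i)\<^sup>2 * N i = Q\<^sup>2 * chain_form (wt \<sigma> i) z"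
    by (simp add: z chain_form_scale)
  have "z 0 = 0" "z (wt \<sigma> i) = 0" using ends[of i] i by (simp_all add: z_def)
  then have "chain_form (wt \<sigma> i) z \<ge> 0" by (rule chain_form_nonneg)
  moreover have "chain_form (wt \<sigma> i) z \<noteq> 0" using sq qi Ni by auto
  ultimately have "Q\<^sup>2 * 1 \<le> Q\<^sup>2 * chain_form (wt \<sigma> i) z" by (intro mult_left_mono) auto
  then have lo: "Q\<^sup>2 \<le> (q i)\<^sup>2 * N i" using sq by simp
  have rest: "Q = q i * N i + (\<Sum>k\<in>{1..arms \<sigma>} - {i}. q k * N k)"
    unfolding Q using i by (simp add: sum.remove)
  have nn: "q k * N k \<ge> 0" if "k \<in> {1..arms \<sigma>}" for k
    using N0[OF that] arm_facts(6)[OF that] by simp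
  then have hi: "q i * N i \<le> Q" unfolding rest using sum_nonneg[of "{1..arms \<sigma>} - {i}" "\<lambda>k. q k * N k"] by simp
  have "(q i * N i)\<^sup>2 \<le> Q\<^sup>2" using hi qi Ni by (intro power_mono) simp_all
  also note lo
  also have "(q i * N i)\<^sup>2 = ((q i)\<^sup>2 * N i) * N i" by (simp add: power2_eq_square)
  finally have "((q i)\<^sup>2 * N i) * N i \<le> ((q i)\<^sup>2 * N i) * 1" by simp
  moreover have "(q i)\<^sup>2 * N i > 0" using qi Ni by simp
  ultimately have "N i \<le> 1" by (simp only: mult_le_cancel_left_pos)
  then have N1: "N i = 1" using Ni by simp
  from lo have "Q\<^sup>2 \<le> (q i)\<^sup>2" unfolding N1 by (simp only: mult_1_right)
  then have "Q \<le> q i" using less_imp_le[OF qi] by (rule power2_le_imp_le)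
  then have Qq: "Q = q i" using hi unfolding N1 by linarith
  have zero: "arm_coord \<beta> k j = 0" if k: "k \<in> {1..arms \<sigma>}" "k \<noteq> i" "j < wt \<sigma> k" for k j
  proof (rule ccontr)
    assume "arm_coord \<beta> k j \<noteq> 0"
    then have "N k > 0" unfolding N_def using ends k by (intro chain_form_pos[of _ _ j]) auto
    then have "q k * N k > 0" using arm_facts(6)[OF k(1)] by simp
    then have "(\<Sum>k\<in>{1..arms \<sigma>} - {i}. q k * N k) > 0"
      using nn k by (intro sum_pos2[of _ k]) auto
    with rest Qq N1 show False by simp
  qed
  show thesis by (rule that[OF i _ _ zero]) (use Qq N1 in \<open>simp_all add: Q_def N_def\<close>)
qed

text \<open>All terms of the tubular equation are positive, so one term is at most \<open>2\<close>, and is the only one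
  if it equals \<open>2\<close>.\<close>

lemma tubular_term_le:
  assumes "tubular \<sigma>" "i \<in> {1..arms \<sigma>}"
  shows "eps \<sigma> * dd \<sigma> i * (wt \<sigma> i - 1) \<le> 2 * wt \<sigma> i"
    and "eps \<sigma> * dd \<sigma> i * (wt \<sigma> i - 1) = 2 * wt \<sigma> i \<Longrightarrow> {1..arms \<sigma>} = {i}"
proof -
  define g where "g k = real (eps \<sigma>) * real (dd \<sigma> k) * (1 - 1 / real (wt \<sigma> k))" for k
  have pos: "g k > 0" if "k \<in> {1..arms \<sigma>}" for k
    using arm_facts(1-3)[OF that] eps_cases
    unfolding g_def arm_facts(4)[OF that, symmetric] by (auto intro!: mult_pos_pos)
  have sum: "(\<Sum>k = 1..arms \<sigma>. g k) = 2" using assms(1) by (simp add: tubular_def g_def)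
  have g: "real (eps \<sigma> * dd \<sigma> i * (wt \<sigma> i - 1)) = g i * wt \<sigma> i"
    using arm_facts(1)[OF assms(2)] by (simp add: g_def field_simps of_nat_diff)
  have "g i \<le> 2"
    unfolding sum[symmetric] using assms(2) pos by (intro member_le_sum) (auto simp: less_imp_le)
  then have "g i * real (wt \<sigma> i) \<le> 2 * real (wt \<sigma> i)" by (intro mult_right_mono) auto
  then show "eps \<sigma> * dd \<sigma> i * (wt \<sigma> i - 1) \<le> 2 * wt \<sigma> i" using g by linarith
  show "{1..arms \<sigma>} = {i}" if eq: "eps \<sigma> * dd \<sigma> i * (wt \<sigma> i - 1) = 2 * wt \<sigma> i"
  proof (rule ccontr)
    assume "{1..arms \<sigma>} \<noteq> {i}"
    then obtain k where "k \<in> {1..arms \<sigma>} - {i}" using assms(2) by blast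
    then have "(\<Sum>k\<in>{1..arms \<sigma>} - {i}. g k) > 0" using pos by (intro sum_pos2[of _ k]) (auto simp: less_imp_le)
    moreover have "g i * real (wt \<sigma> i) = 2 * real (wt \<sigma> i)" using g unfolding eq by simp
    then have "g i = 2" using arm_facts(1)[OF assms(2)] by simp
    ultimately show False using sum sum.remove[of "{1..arms \<sigma>}" i g] assms(2) by simp
  qed
qed

text \<open>Neither \<open>f\<close> nor \<open>k\<close> can be \<open>1\<close>, as \<open>p\<close> does not divide \<open>S\<close>; then \<open>4 (p - 1) \<le> 2 p\<close>.\<close>

lemma divisibility_forces_exceptional:
  fixes p d f e k S :: int
  assumes "p \<ge> 2" "f \<ge> 1" "k \<ge> 1" "k * f * (p - 1) \<le> 2 * p"
    and "S \<noteq> 0" "\<bar>S\<bar> < p" "p dvd f * S" "p dvd k * S"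
  shows "p = 2 \<and> f = 2 \<and> k = 2"
proof -
  have nd: "\<not> p dvd S" using assms zdvd_imp_le[of p "\<bar>S\<bar>"] by auto
  with assms have "f \<noteq> 1" "k \<noteq> 1" by auto
  with assms have fk: "f \<ge> 2" "k \<ge> 2" by auto
  then have "2 * 2 \<le> k * f" by (intro mult_mono) auto
  then have "4 * (p - 1) \<le> k * f * (p - 1)" using assms by (intro mult_right_mono) auto
  also note assms(4)
  finally have p: "p = 2" using assms(1) by presburger
  with assms have kf: "k * f \<le> 4" by simp
  have "2 * f \<le> k * f" "k * 2 \<le> k * f" using fk by (auto intro: mult_right_mono mult_left_mono)
  with kf fk p show ?thesis by linarith
qed

text \<open>In rank 3 with \<open>p = f = \<epsilon> e = 2\<close>, norms and coroots do not detect that some vectors are no roots.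
  Here the Cartan integers are congruent modulo 2 to \<open>e a\<close> or to \<open>0\<close>, where \<open>a\<close> is the coordinate at
  \<open>\<alpha>\<^sub>0\<close>.  Hence the parity of \<open>e a\<close> is invariant, and if \<open>e a\<close> is even, the parities of the two other
  coordinates are invariant too.  A simple root never has both of these odd.\<close>

lemma exceptional_parity:
  assumes one: "{1..arms \<sigma>} = {i}" and p: "wt \<sigma> i = 2" and f: "ff \<sigma> i = 2" and ee: "eps \<sigma> * ee \<sigma> i = 2"
    and root: "\<beta> \<in> roots" and even: "even (e i * coord \<beta> Zero)"
  shows "even (coord \<beta> (Arm i 1)) \<or> even (coord \<beta> ZeroStar)"
proof -
  have i: "i \<in> {1..arms \<sigma>}" using one by simp
  have V: "V = {Arm i 1, Zero, ZeroStar}"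
  proof -
    have "V = (\<Union>k\<in>{1..arms \<sigma>}. Arm k ` {1..<wt \<sigma> k}) \<union> {Zero, ZeroStar}"
      unfolding set_basis by force
    moreover have "{1..<wt \<sigma> i} = {1}" unfolding p by auto
    ultimately show ?thesis unfolding one by auto
  qed
  have \<epsilon>e: "\<epsilon> * e i = 2" using ee by (metis of_nat_mult of_nat_numeral)
  have qe: "q i * e i = int \<kappa> * \<epsilon> * 2" using arm_facts(5)[OF i] f by simp
  have cA: "cartan y (Arm i 1) = 2 * coord y (Arm i 1) - e i * rk y" if "y \<in> L" for y
  proof -
    have "arm_coord y i 2 = 0" using arm_coord_end[OF that i] p by simp
    then have "cartan y (Arm i 1) * q i = (2 * coord y (Arm i 1) - e i * rk y) * q i"
      using cartan_mult[of "Arm i 1" y] B_Arm[of i 1 y] that V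
      by (simp add: q_def arm_coord_def numeral_2_eq_2 algebra_simps)
    then show ?thesis using arm_facts(6)[OF i] by simp
  qed
  have BZ: "B y (frag_of Zero) = int \<kappa> * (2 * rk y - 2 * \<epsilon> * coord y (Arm i 1))" if "y \<in> L" for y
    using B_Zero(1)[OF that] unfolding one by (simp only: sum.insert sum.empty finite.emptyI empty_iff not_False_eq_True qe)
      (simp add: arm_coord_def algebra_simps)
  have cZ: "cartan y Zero = 2 * rk y - 2 * \<epsilon> * coord y (Arm i 1)" if "y \<in> L" for y
  proof -
    have "cartan y Zero * int \<kappa> = (2 * rk y - 2 * \<epsilon> * coord y (Arm i 1)) * int \<kappa>"
      using cartan_mult[of Zero y] that V BZ[OF that] by simp
    then show ?thesis using kappa_pos mult_cancel_right by (metis of_nat_0_eq_iff not_one_le_zero)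
  qed
  have cS: "cartan y ZeroStar = e i * rk y - 2 * coord y (Arm i 1)" if "y \<in> L" for y
  proof -
    have "cartan y ZeroStar * (int \<kappa> * \<epsilon>\<^sup>2) = (int \<kappa> * \<epsilon>) * (2 * rk y - 2 * \<epsilon> * coord y (Arm i 1))"
      using cartan_mult[of ZeroStar y] that V BZ[OF that] B_Zero(2)[OF that] by simp
    also have "\<dots> = (int \<kappa> * \<epsilon>) * (\<epsilon> * e i * rk y - 2 * \<epsilon> * coord y (Arm i 1))" by (simp only: \<epsilon>e)
    also have "\<dots> = (e i * rk y - 2 * coord y (Arm i 1)) * (int \<kappa> * \<epsilon>\<^sup>2)"
      by (simp add: power2_eq_square algebra_simps)
    finally show ?thesis using kappa_pos eps_cases by auto
  qed
  have erk: "e i * rk y = e i * coord y Zero + 2 * coord y ZeroStar" for y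
  proof -
    have "e i * rk y = e i * coord y Zero + (\<epsilon> * e i) * coord y ZeroStar"
      by (simp add: rk_def algebra_simps)
    then show ?thesis by (simp only: \<epsilon>e)
  qed
  show ?thesis
    using root even
  proof (induction rule: roots.induct)
    case (simple v)
    then show ?case unfolding V by (auto simp: lookup_frag_of)
  next
    case (reflect \<beta> v)
    then have \<beta>: "\<beta> \<in> L" using roots_subset by simp
    have eZ: "even (e i * cartan \<beta> Zero)" by (simp add: cZ[OF \<beta>])
    have ev: "even (e i * coord \<beta> Zero)"
      using reflect.prems eZ by (cases "v = Zero") (simp_all add: lookup_s \<beta> right_diff_distrib)
    then have "even (cartan \<beta> (Arm i 1))" "even (cartan \<beta> ZeroStar)"
      unfolding cA[OF \<beta>] cS[OF \<beta>] erk by simp_all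
    then show ?case
      using reflect.IH[OF ev] by (auto simp: lookup_s \<beta>)
  qed
qed

theorem no_root_radical_orth:
  assumes tub: "tubular \<sigma>" and root: "\<beta> \<in> roots"
  shows "\<not> radical_orth \<beta>"
proof
  assume orth: "radical_orth \<beta>"
  note rk = radical_orth_coords(1)[OF orth]
  obtain i where i: "i \<in> {1..arms \<sigma>}" and Q: "K \<beta> \<beta> = q i"
    and N: "chain_form (wt \<sigma> i) (arm_coord \<beta> i) = 1"
    and zero: "\<And>k j. k \<in> {1..arms \<sigma>} \<Longrightarrow> k \<noteq> i \<Longrightarrow> j < wt \<sigma> k \<Longrightarrow> arm_coord \<beta> k j = 0"
    using root_on_one_arm[OF root rk] by metis
  note af = arm_facts[OF i]
  define S where "S = (\<Sum>j = 1..<wt \<sigma> i. arm_coord \<beta> i j)"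
  define b where "b = coord \<beta> ZeroStar"
  have "arm_coord \<beta> i 0 = 0" using rk by (simp add: arm_coord_def)
  then have S: "S \<noteq> 0" "\<bar>S\<bar> < int (wt \<sigma> i)"
    unfolding S_def using arm_coord_end[OF roots_subset[OF root] i] N by (intro chain_form_one_sum; simp)+
  have "(\<Sum>k = 1..arms \<sigma>. ff \<sigma> k * (\<Sum>j = 1..<wt \<sigma> k. arm_coord \<beta> k j) / wt \<sigma> k) =
      (\<Sum>k = 1..arms \<sigma>. if k = i then ff \<sigma> i * real_of_int S / wt \<sigma> i else 0)"
    by (intro sum.cong refl) (simp add: S_def zero)
  then have "ff \<sigma> i * real_of_int S / wt \<sigma> i = - real_of_int b"
    using radical_orth_coords(2)[OF orth] i by (simp add: b_def)
  then have "real_of_int (f i * S) = real_of_int (- int (wt \<sigma> i) * b)"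
    using af(1) by (simp add: field_simps)
  then have fS: "f i * S = - int (wt \<sigma> i) * b" by (simp only: of_int_eq_iff)
  then have d1: "int (wt \<sigma> i) dvd f i * S" by simp
  (* Integrality of the coroot, at the coordinate of ZeroStar this time. *)
  have "q i dvd int \<kappa> * \<epsilon>\<^sup>2 * b"
    using root_norm_dvd_coord[OF root special_vertices(2)] by (simp add: Q b_def)
  then have "int \<kappa> * \<epsilon> * f i dvd int \<kappa> * \<epsilon>\<^sup>2 * b * e i"
    unfolding af(5)[symmetric] by (rule mult_dvd_mono) simp
  then have "(int \<kappa> * \<epsilon>) * f i dvd (int \<kappa> * \<epsilon>) * (\<epsilon> * e i * b)"
    by (simp add: power2_eq_square mult_ac)
  then have "f i dvd \<epsilon> * e i * b"
    using kappa_pos eps_cases by (subst (asm) dvd_mult_cancel_left) auto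
  then have "f i * int (wt \<sigma> i) dvd \<epsilon> * e i * b * int (wt \<sigma> i)" by (rule mult_dvd_mono) simp
  also have "\<epsilon> * e i * b * int (wt \<sigma> i) = \<epsilon> * e i * - (f i * S)"
    unfolding fS by simp
  also have "\<dots> = f i * - (\<epsilon> * e i * S)" by simp
  finally have d2: "int (wt \<sigma> i) dvd \<epsilon> * e i * S"
    using af(2) by (subst (asm) dvd_mult_cancel_left) auto
  have "int (eps \<sigma> * dd \<sigma> i * (wt \<sigma> i - 1)) \<le> int (2 * wt \<sigma> i)"
    using tubular_term_le(1)[OF tub i] by (simp only: of_nat_le_iff)
  moreover have "int (eps \<sigma> * dd \<sigma> i * (wt \<sigma> i - 1)) = \<epsilon> * e i * f i * (int (wt \<sigma> i) - 1)"
    unfolding af(4)[symmetric] using af(1) by (simp add: of_nat_diff)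
  ultimately have "\<epsilon> * e i * f i * (int (wt \<sigma> i) - 1) \<le> int (2 * wt \<sigma> i)" by (simp only:)
  then have "\<epsilon> * e i * f i * (int (wt \<sigma> i) - 1) \<le> 2 * int (wt \<sigma> i)" by simp
  moreover have "\<epsilon> * e i \<ge> 1" using af(3) eps_cases by auto
  ultimately have "int (wt \<sigma> i) = 2 \<and> f i = 2 \<and> \<epsilon> * e i = 2"
    using af S d1 d2 by (intro divisibility_forces_exceptional) auto
  then have ex: "wt \<sigma> i = 2" "ff \<sigma> i = 2" "eps \<sigma> * ee \<sigma> i = 2"
    by (simp_all flip: of_nat_mult)
  (* The i-th term already exhausts the tubular equation, so there is no other arm. *)
  then have "eps \<sigma> * dd \<sigma> i = 4" unfolding af(4)[symmetric] by simp
  then have one: "{1..arms \<sigma>} = {i}" using tubular_term_le(2)[OF tub i] ex by simp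
  have "{1..<wt \<sigma> i} = {1}" using ex by auto
  then have "S = coord \<beta> (Arm i 1)" by (simp add: S_def arm_coord_def)
  moreover have "odd S" using S ex by (auto simp: abs_less_iff)
  moreover have "b = - S" using fS ex by simp
  moreover have "even (e i * coord \<beta> Zero)"
  proof -
    have "coord \<beta> Zero = - \<epsilon> * b" using rk by (simp add: rk_def b_def)
    then have "e i * coord \<beta> Zero = - int (eps \<sigma> * ee \<sigma> i) * b" by simp
    then show ?thesis unfolding ex(3) by simp
  qed
  ultimately show False
    using exceptional_parity[OF one ex root] by (simp add: b_def)
qed

section \<open>The Coxeter element and the bilinear form\<close>

lemma G_mult: "\<phi> \<in> carrier G \<Longrightarrow> \<psi> \<in> carrier G \<Longrightarrow> y \<in> L \<Longrightarrow> (\<phi> \<otimes>\<^bsub>G\<^esub> \<psi>) y = \<phi> (\<psi> y)"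
  using G_D(1)[of \<phi>] G_D(1)[of \<psi>] by (simp add: isometry_group_def BijGroup_def compose_def)

lemma G_one: "y \<in> L \<Longrightarrow> \<one>\<^bsub>G\<^esub> y = y"
  by (simp add: isometry_group_def BijGroup_def)

sublocale G: group G
  by (rule group_isometry_group)

lemma product_list_Cons: "product_list G (x # xs) = x \<otimes>\<^bsub>G\<^esub> product_list G xs"
  by (simp add: product_list_def)

lemma product_list_closed: "set xs \<subseteq> carrier G \<Longrightarrow> product_list G xs \<in> carrier G"
  by (induction xs) (simp_all add: product_list_def)

lemma gram_triangular: "sorted_wrt (\<lambda>a b. gram \<sigma> \<kappa> b a = 0) (basis \<sigma>)"
proof -
  have "sorted_wrt (\<lambda>j k. k < j) (rev [1..<n])" for n :: nat
    unfolding sorted_wrt_rev by (rule sorted_wrt_upt)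
  then have arm: "sorted_wrt (\<lambda>a b. gram \<sigma> \<kappa> b a = 0) (map (Arm i) (rev [1..<n]))" for i n
    unfolding sorted_wrt_map by (rule sorted_wrt_mono_rel[rotated]) auto
  have "sorted_wrt (\<lambda>a b. gram \<sigma> \<kappa> b a = 0) (concat (map (\<lambda>i. map (Arm i) (rev [1..<wt \<sigma> i])) is))"
    if "distinct is" for "is"
    using that by (induction "is") (auto simp: sorted_wrt_append arm[simplified])
  then show ?thesis
    unfolding basis_def sorted_wrt_append by auto
qed

lemma Kform_zero: "K 0 y = 0" "K x 0 = 0"
  by (simp_all add: Kform_def)

lemma Kform_diff: "K (x - y) z = K x z - K y z" "K z (x - y) = K z x - K z y"
  using Kform_add(1)[of \<sigma> \<kappa> "x - y" y z] Kform_add(2)[of \<sigma> \<kappa> z "x - y" y] by simp_all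

text \<open>Let \<open>P\<close> be the product of the simple reflections along a list for which \<open>K\<close> is triangular.  The
  first claim says that \<open>y - P y\<close> lies in the span of the list, in the only form that is needed when the
  list is extended at the front: an element that the list annihilates from the left under \<open>K\<close> is
  annihilated by \<open>y - P y\<close>.  In the matrix notation the second claim is the familiar
  \<open>1 - c = K\<^sup>-\<^sup>1 (K + K\<^sup>T)\<close>.\<close>

lemma product_of_simple_reflections_K:
  assumes "set l \<subseteq> V" "sorted_wrt (\<lambda>a b. gram \<sigma> \<kappa> b a = 0) l" "y \<in> L"
  defines "P \<equiv> product_list G (map s l)"
  shows "(\<And>b. b \<in> set l \<Longrightarrow> K (frag_of b) x = 0) \<Longrightarrow> K (y - P y) x = 0"
    and "b \<in> set l \<Longrightarrow> K (frag_of b) (y - P y) = B (frag_of b) y"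
proof -
  define D where "D l = y - product_list G (map s l) y" for l
  have "(\<forall>x. (\<forall>b\<in>set l. K (frag_of b) x = 0) \<longrightarrow> K (D l) x = 0)
      \<and> (\<forall>b\<in>set l. K (frag_of b) (D l) = B (frag_of b) y)"
    using assms(1,2)
  proof (induction l)
    case Nil
    then show ?case using G_one[OF assms(3)] by (simp add: D_def product_list_def Kform_zero)
  next
    case (Cons a l)
    define y' where "y' = product_list G (map s l) y"
    have aV: "a \<in> V" and lV: "set l \<subseteq> V" and tri: "\<And>b. b \<in> set l \<Longrightarrow> gram \<sigma> \<kappa> b a = 0"
      using Cons.prems by auto
    have closed: "product_list G (map s l) \<in> carrier G"
      using lV by (intro product_list_closed) (auto intro: s_in_G)
    have y'L: "y' \<in> L" unfolding y'_def by (rule G_D(2)[OF closed assms(3)])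
    have step: "D (a # l) = D l + frag_cmul (cartan y' a) (frag_of a)"
      using G_mult[OF s_in_G[OF aV] closed assms(3)] s_apply[OF y'L, of a]
      by (simp add: D_def product_list_Cons y'_def)
    have K0: "K (frag_of b) (frag_of a) = 0" if "b \<in> set l" for b
      using tri[OF that] that lV aV by (subst Kform_basis) auto
    have IH1: "K (D l) x = 0" if "\<And>b. b \<in> set l \<Longrightarrow> K (frag_of b) x = 0" for x
      using Cons that by auto
    have IH2: "K (frag_of b) (D l) = B (frag_of b) y" if "b \<in> set l" for b
      using Cons that by auto
    have "cartan y' a * K (frag_of a) (frag_of a) = B y' (frag_of a)"
      using cartan_mult[OF aV y'L] aV by (simp add: Kform_basis)
    also have "B y' (frag_of a) = B (y - D l) (frag_of a)" by (simp add: D_def y'_def)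
    also have "\<dots> = B (frag_of a) y - K (frag_of a) (D l)"
      using IH1[OF K0] by (simp add: Bform_def Kform_diff)
    finally have "K (frag_of a) (D (a # l)) = B (frag_of a) y"
      by (simp add: step Kform_add Kform_cmul)
    moreover have "K (frag_of b) (D (a # l)) = B (frag_of b) y" if "b \<in> set l" for b
      using IH2[OF that] K0[OF that] by (simp add: step Kform_add Kform_cmul)
    moreover have "K (D (a # l)) x = 0" if "\<forall>b\<in>set (a # l). K (frag_of b) x = 0" for x
      using IH1 that by (simp add: step Kform_add Kform_cmul)
    ultimately show ?case by simp
  qed
  then show "(\<And>b. b \<in> set l \<Longrightarrow> K (frag_of b) x = 0) \<Longrightarrow> K (y - P y) x = 0"
    and "b \<in> set l \<Longrightarrow> K (frag_of b) (y - P y) = B (frag_of b) y"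
    by (simp_all add: D_def P_def)
qed

abbreviation "c \<equiv> coxeter \<sigma> \<kappa>"

lemma K_coxeter: "v \<in> V \<Longrightarrow> y \<in> L \<Longrightarrow> K (frag_of v) (y - c y) = B (frag_of v) y"
  unfolding coxeter_def using product_of_simple_reflections_K(2)[OF _ gram_triangular] by simp

lemma B_expand_left: "B y \<beta> = (\<Sum>v\<in>V. coord y v * B (frag_of v) \<beta>)"
proof -
  have "K \<beta> y = (\<Sum>v\<in>V. coord y v * K \<beta> (frag_of v))"
    unfolding Kform_def[of \<sigma> \<kappa> \<beta> y]
    by (subst sum.swap, intro sum.cong refl)
       (simp add: Kform_frag_of_right sum_distrib_left mult_ac)
  then show ?thesis
    unfolding Bform_def using Kform_expand_left[of \<sigma> \<kappa> y \<beta>] by (simp add: distrib_left sum.distrib)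
qed

text \<open>Fixed vectors of \<open>c\<close> lie in the radical of \<open>B\<close>, and the form is positive definite on the span of
  the arms.\<close>

lemma coxeter_fixed_eq_0:
  assumes y: "y \<in> L" and fixed: "c y = y" and "coord y Zero = 0" "coord y ZeroStar = 0"
  shows "y = 0"
proof -
  have "B (frag_of v) y = 0" if "v \<in> V" for v
    using K_coxeter[OF that y] fixed by (simp add: Kform_zero)
  then have "K y y = 0" using B_expand_left[of y y] by (simp add: B_self)
  moreover have rk: "rk y = 0" using assms by (simp add: rk_def)
  ultimately have sum0: "(\<Sum>i = 1..arms \<sigma>. q i * chain_form (wt \<sigma> i) (arm_coord y i)) = 0"
    by (simp add: K_self)
  have ends: "arm_coord y i 0 = 0" for i using rk by (simp add: arm_coord_def)
  have nn: "chain_form (wt \<sigma> i) (arm_coord y i) \<ge> 0" if "i \<in> {1..arms \<sigma>}" for i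
    using arm_coord_end[OF y that] ends by (intro chain_form_nonneg) auto
  have "q i * chain_form (wt \<sigma> i) (arm_coord y i) = 0" if "i \<in> {1..arms \<sigma>}" for i
    using sum0 that nn arm_facts(6)
    by (subst (asm) sum_nonneg_eq_0_iff) (auto simp: less_imp_le)
  then have chain0: "chain_form (wt \<sigma> i) (arm_coord y i) = 0" if "i \<in> {1..arms \<sigma>}" for i
    using that arm_facts(6)[OF that] by force
  have "coord y v = 0" for v
  proof (cases "v \<in> V")
    case True
    show ?thesis
    proof (cases v)
      case (Arm i j)
      then have ij: "i \<in> {1..arms \<sigma>}" "1 \<le> j" "j < wt \<sigma> i" using True by (auto simp: set_basis)
      then show ?thesis
        using chain_form_pos[of "arm_coord y i" "wt \<sigma> i" j] chain0[OF ij(1)] ends arm_coord_end[OF y ij(1)] Arm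
        by (force simp: arm_coord_def)
    qed (use assms in simp_all)
  qed (simp add: lookup_outside[OF y])
  then show ?thesis by (intro poly_mapping_eqI) simp
qed

section \<open>Reflections and their roots\<close>

lemma G_zero: "\<phi> \<in> carrier G \<Longrightarrow> \<phi> 0 = 0"
  using G_D(3)[of \<phi> 0 0] by (simp add: carrier_lattice)

lemma L_closed:
  "x \<in> L \<Longrightarrow> y \<in> L \<Longrightarrow> x + y \<in> L" "x \<in> L \<Longrightarrow> y \<in> L \<Longrightarrow> x - y \<in> L" "x \<in> L \<Longrightarrow> frag_cmul k x \<in> L"
  using Poly_Mapping.keys_add[of x y] keys_diff[of x y] keys_cmul[of k x] unfolding carrier_lattice by blast+

lemma G_diff:
  assumes "\<phi> \<in> carrier G" "x \<in> L" "y \<in> L"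
  shows "\<phi> (x - y) = \<phi> x - \<phi> y"
  using G_D(3)[OF assms(1), of "x - y" y] assms by (simp add: L_closed)

lemma coord_G_expand:
  assumes \<phi>: "\<phi> \<in> carrier G" and y: "y \<in> L"
  shows "coord (\<phi> y) u = (\<Sum>v\<in>V. coord y v * coord (\<phi> (frag_of v)) u)"
proof -
  have "Poly_Mapping.keys y \<subseteq> V" using y by (simp add: carrier_lattice)
  then have "y \<in> L \<and> coord (\<phi> y) u = (\<Sum>v\<in>V. coord y v * coord (\<phi> (frag_of v)) u)"
  proof (induction y rule: frag_induction)
    case zero
    then show ?case by (simp add: G_zero[OF \<phi>] carrier_lattice)
  next
    case (one v)
    then show ?case by (simp add: lookup_frag_of frag_of_in_L if_distrib[of "\<lambda>x. x * _"] cong: if_cong)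
  next
    case (diff x y)
    then show ?case
      by (simp add: G_diff[OF \<phi>] L_closed lookup_minus left_diff_distrib sum_subtractf)
  qed
  then show ?thesis ..
qed

lemma G_cmul:
  assumes "\<phi> \<in> carrier G" "x \<in> L"
  shows "\<phi> (frag_cmul k x) = frag_cmul k (\<phi> x)"
  by (rule poly_mapping_eqI)
     (simp add: coord_G_expand[OF assms(1)] L_closed assms sum_distrib_left mult.assoc)

lemma weyl_closed: "w \<in> weyl_group \<sigma> \<kappa> \<Longrightarrow> w \<in> carrier G"
  unfolding weyl_group_def
  by (rule G.generate_in_carrier) (auto simp: simple_reflections_def s_in_G)

lemma weyl_roots:
  assumes "w \<in> weyl_group \<sigma> \<kappa>" "\<beta> \<in> roots"
  shows "w \<beta> \<in> roots"
  using assms unfolding weyl_group_def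
proof (induction arbitrary: \<beta> rule: generate.induct)
  case one
  then show ?case by (simp add: G_one roots_subset)
next
  case (incl h)
  then show ?case by (auto simp: simple_reflections_def intro: roots.reflect)
next
  case (inv h)
  then obtain v where v: "v \<in> V" "h = s v" by (auto simp: simple_reflections_def)
  have \<beta>: "\<beta> \<in> L" using inv roots_subset by simp
  note sG = s_in_G[OF v(1)]
  have "s v ((inv\<^bsub>G\<^esub> s v) \<beta>) = \<beta>"
    using G_mult[OF sG G.inv_closed[OF sG] \<beta>] G_one[OF \<beta>] sG by simp
  then have "(inv\<^bsub>G\<^esub> s v) \<beta> = s v \<beta>"
    using s_involutive[OF v(1) G_D(2)[OF G.inv_closed[OF sG] \<beta>]] by simp
  then show ?case using inv v by (auto intro: roots.reflect)
next
  case (eng h1 h2)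
  then show ?case
    using weyl_closed[of h1] weyl_closed[of h2] by (simp add: G_mult roots_subset weyl_group_def)
qed

lemma reflections_closed: "t \<in> reflections \<sigma> \<kappa> \<Longrightarrow> t \<in> carrier G"
  by (auto simp: reflections_def simple_reflections_def s_in_G weyl_closed)

lemma reflection_has_root:
  assumes "t \<in> reflections \<sigma> \<kappa>"
  obtains \<beta> where "\<beta> \<in> roots"
    "\<And>y. y \<in> L \<Longrightarrow> \<exists>k. t y = y - frag_cmul k \<beta> \<and> k * K \<beta> \<beta> = B y \<beta>"
proof -
  obtain w v where w: "w \<in> weyl_group \<sigma> \<kappa>" and v: "v \<in> V"
    and t: "t = w \<otimes>\<^bsub>G\<^esub> s v \<otimes>\<^bsub>G\<^esub> inv\<^bsub>G\<^esub> w"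
    using assms by (auto simp: reflections_def simple_reflections_def)
  note wG = weyl_closed[OF w] and sG = s_in_G[OF v] and vL = frag_of_in_L[OF v]
  define \<beta> where "\<beta> = w (frag_of v)"
  have K\<beta>: "K \<beta> \<beta> = gram \<sigma> \<kappa> v v"
    using G_D(4)[OF wG vL vL] v by (simp add: \<beta>_def B_self Kform_basis)
  show thesis
  proof (rule that)
    show "\<beta> \<in> roots" unfolding \<beta>_def by (rule weyl_roots[OF w roots.simple[OF v]])
    fix y assume y: "y \<in> L"
    define x where "x = (inv\<^bsub>G\<^esub> w) y"
    have x: "x \<in> L" unfolding x_def by (rule G_D(2)[OF G.inv_closed[OF wG] y])
    have wx: "w x = y"
      using G_mult[OF wG G.inv_closed[OF wG] y] G_one[OF y] wG by (simp add: x_def)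
    have "t y = w (s v x)"
      unfolding t using wG sG y by (simp add: G_mult x G_D(2)[of "inv\<^bsub>G\<^esub> w"] flip: x_def)
    also have "\<dots> = y - frag_cmul (cartan x v) \<beta>"
      by (simp add: s_apply[OF x] G_diff[OF wG] G_cmul[OF wG] L_closed x vL wx \<beta>_def)
    finally have "t y = y - frag_cmul (cartan x v) \<beta>" .
    moreover have "cartan x v * K \<beta> \<beta> = B y \<beta>"
      using cartan_mult[OF v x] G_D(4)[OF wG x vL] unfolding K\<beta> by (simp add: wx \<beta>_def)
    ultimately show "\<exists>k. t y = y - frag_cmul k \<beta> \<and> k * K \<beta> \<beta> = B y \<beta>" by blast
  qed
qed

lemma simple_in_reflections:
  assumes "v \<in> V"
  shows "s v \<in> reflections \<sigma> \<kappa>"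
proof -
  have "\<one>\<^bsub>G\<^esub> \<otimes>\<^bsub>G\<^esub> s v \<otimes>\<^bsub>G\<^esub> inv\<^bsub>G\<^esub> \<one>\<^bsub>G\<^esub> = s v" using s_in_G[OF assms] by simp
  then show ?thesis
    unfolding reflections_def weyl_group_def simple_reflections_def
    using generate.one[of G] assms by (intro CollectI exI[of _ "\<one>\<^bsub>G\<^esub>"] exI[of _ "s v"]) auto
qed

section \<open>Determinants of products of reflections\<close>

definition mat_of :: "((vertex \<Rightarrow>\<^sub>0 int) \<Rightarrow> (vertex \<Rightarrow>\<^sub>0 int)) \<Rightarrow> int mat" where
  "mat_of \<phi> = mat (rank \<sigma>) (rank \<sigma>) (\<lambda>(i, j). coord (\<phi> (frag_of (basis \<sigma> ! j))) (basis \<sigma> ! i))"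

lemma mat_of_carrier: "mat_of \<phi> \<in> carrier_mat (rank \<sigma>) (rank \<sigma>)"
  by (simp add: mat_of_def)

lemma basis_nth: "i < rank \<sigma> \<Longrightarrow> basis \<sigma> ! i \<in> V"
  by (metis length_basis nth_mem)

lemma basis_nth_eq_iff: "i < rank \<sigma> \<Longrightarrow> j < rank \<sigma> \<Longrightarrow> basis \<sigma> ! i = basis \<sigma> ! j \<longleftrightarrow> i = j"
  by (simp add: nth_eq_iff_index_eq distinct_basis length_basis)

lemma sum_basis_nth: "(\<Sum>v\<in>V. g v) = (\<Sum>i = 0..<rank \<sigma>. g (basis \<sigma> ! i))"
  by (subst sum.reindex_bij_betw[of "(!) (basis \<sigma>)" "{0..<rank \<sigma>}" V g, symmetric])
     (auto intro!: bij_betw_nth simp: distinct_basis length_basis)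

lemma mat_of_mult:
  assumes "\<phi> \<in> carrier G" "\<psi> \<in> carrier G"
  shows "mat_of (\<phi> \<otimes>\<^bsub>G\<^esub> \<psi>) = mat_of \<phi> * mat_of \<psi>"
proof (rule eq_matI)
  fix i j assume "i < dim_row (mat_of \<phi> * mat_of \<psi>)" "j < dim_col (mat_of \<phi> * mat_of \<psi>)"
  then have ij: "i < rank \<sigma>" "j < rank \<sigma>" by (simp_all add: mat_of_def)
  have L: "frag_of (basis \<sigma> ! j) \<in> L" using frag_of_in_L[OF basis_nth[OF ij(2)]] .
  have "coord ((\<phi> \<otimes>\<^bsub>G\<^esub> \<psi>) (frag_of (basis \<sigma> ! j))) (basis \<sigma> ! i) =
      (\<Sum>k = 0..<rank \<sigma>. coord (\<psi> (frag_of (basis \<sigma> ! j))) (basis \<sigma> ! k) * coord (\<phi> (frag_of (basis \<sigma> ! k))) (basis \<sigma> ! i))"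
    using G_mult[OF assms L] coord_G_expand[OF assms(1) G_D(2)[OF assms(2) L]] by (simp add: sum_basis_nth)
  then show "mat_of (\<phi> \<otimes>\<^bsub>G\<^esub> \<psi>) $$ (i, j) = (mat_of \<phi> * mat_of \<psi>) $$ (i, j)"
    using ij by (simp add: mat_of_def scalar_prod_def mult.commute)
qed (simp_all add: mat_of_def)

lemma mat_of_one: "mat_of \<one>\<^bsub>G\<^esub> = 1\<^sub>m (rank \<sigma>)"
  by (rule eq_matI)
     (auto simp: mat_of_def G_one frag_of_in_L basis_nth lookup_frag_of basis_nth_eq_iff)

lemma det_mult_G:
  "\<phi> \<in> carrier G \<Longrightarrow> \<psi> \<in> carrier G \<Longrightarrow> det (mat_of (\<phi> \<otimes>\<^bsub>G\<^esub> \<psi>)) = det (mat_of \<phi>) * det (mat_of \<psi>)"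
  by (simp add: mat_of_mult det_mult[OF mat_of_carrier mat_of_carrier])

text \<open>The matrix differs from the identity in the row of \<open>v\<close> only, so just the identity permutation
  contributes to the Leibniz formula; the diagonal entry in that row is \<open>1 - 2\<close>.\<close>

lemma det_simple_reflection:
  assumes v: "v \<in> V"
  shows "det (mat_of (s v)) = -1"
proof -
  let ?n = "rank \<sigma>"
  obtain a where a: "a < ?n" "basis \<sigma> ! a = v"
    using v by (auto simp: in_set_conv_nth length_basis)
  have entry: "mat_of (s v) $$ (i, j) = (if i = j then 1 else 0) - (if i = a then cartan (frag_of (basis \<sigma> ! j)) v else 0)"
    if "i < ?n" "j < ?n" for i j
    using that a by (auto simp: mat_of_def lookup_s frag_of_in_L basis_nth lookup_frag_of basis_nth_eq_iff)
  have "cartan (frag_of v) v * gram \<sigma> \<kappa> v v = 2 * gram \<sigma> \<kappa> v v"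
    using cartan_mult[OF v frag_of_in_L[OF v]] B_simple[OF v] by simp
  then have "cartan (frag_of v) v = 2" using gram_pos[OF v] by simp
  then have diag: "mat_of (s v) $$ (i, i) = (if i = a then -1 else 1)" if "i < ?n" for i
    using entry[OF that that] a by simp
  have only_id: "(\<Prod>i = 0..<?n. mat_of (s v) $$ (i, p i)) = 0" if p: "p permutes {0..<?n}" "p \<noteq> id" for p
  proof -
    have "\<exists>i\<in>{0..<?n}. i \<noteq> a \<and> p i \<noteq> i"
    proof (rule ccontr)
      assume "\<not> ?thesis"
      then have fixed: "p i = i" if "i \<noteq> a" for i
        using that permutes_not_in[OF p(1)] by (cases "i \<in> {0..<?n}") auto
      then have "p a = a" using permutes_inj[OF p(1)] by (metis injD)
      with fixed have "p = id" by (metis eq_id_iff)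
      with p(2) show False by simp
    qed
    then obtain i where i: "i \<in> {0..<?n}" "i \<noteq> a" "p i \<noteq> i" by blast
    moreover have "p i < ?n" using permutes_in_image[OF p(1)] i(1) by simp
    ultimately have "mat_of (s v) $$ (i, p i) = 0" using entry[of i "p i"] by simp
    then show ?thesis using i(1) by (intro prod_zero) auto
  qed
  have "det (mat_of (s v)) = (\<Sum>p\<in>{p. p permutes {0..<?n}}. signof p * (\<Prod>i = 0..<?n. mat_of (s v) $$ (i, p i)))"
    by (rule det_def'[OF mat_of_carrier])
  also have "\<dots> = (\<Sum>p\<in>{id}. signof p * (\<Prod>i = 0..<?n. mat_of (s v) $$ (i, p i)))"
    by (rule sum.mono_neutral_right) (auto simp: finite_permutations permutes_id only_id)
  also have "\<dots> = (\<Prod>i = 0..<?n. if i = a then -1 else 1)"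
    using prod.cong[OF refl diag, of "{0..<?n}"] by simp
  also have "\<dots> = -1" using a by simp
  finally show ?thesis .
qed

lemma det_reflection:
  assumes "t \<in> reflections \<sigma> \<kappa>"
  shows "det (mat_of t) = -1"
proof -
  obtain w v where w: "w \<in> weyl_group \<sigma> \<kappa>" and v: "v \<in> V"
    and t: "t = w \<otimes>\<^bsub>G\<^esub> s v \<otimes>\<^bsub>G\<^esub> inv\<^bsub>G\<^esub> w"
    using assms by (auto simp: reflections_def simple_reflections_def)
  note wG = weyl_closed[OF w] and sG = s_in_G[OF v]
  have "det (mat_of w) * det (mat_of (inv\<^bsub>G\<^esub> w)) = 1"
    using det_mult_G[OF wG G.inv_closed[OF wG]] wG by (simp add: mat_of_one)
  moreover have "det (mat_of t) = det (mat_of w) * -1 * det (mat_of (inv\<^bsub>G\<^esub> w))"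
    unfolding t using wG sG by (simp add: det_mult_G det_simple_reflection[OF v])
  ultimately show ?thesis by simp
qed

lemma det_product_list:
  assumes "set ts \<subseteq> reflections \<sigma> \<kappa>"
  shows "det (mat_of (product_list G ts)) = (-1) ^ length ts"
  using assms
proof (induction ts)
  case Nil
  then show ?case by (simp add: product_list_def mat_of_one)
next
  case (Cons t ts)
  then have "t \<in> carrier G" "product_list G ts \<in> carrier G"
    by (auto intro: product_list_closed reflections_closed)
  with Cons show ?case by (simp add: product_list_Cons det_mult_G det_reflection)
qed

lemma common_zero:
  assumes "length hs < rank \<sigma>"
    and lin: "\<And>h y. h \<in> set hs \<Longrightarrow> y \<in> L \<Longrightarrow> h y = (\<Sum>v\<in>V. coord y v * h (frag_of v))"
  obtains y where "y \<in> L" "y \<noteq> 0" "\<And>h. h \<in> set hs \<Longrightarrow> h y = 0"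
proof -
  obtain x where x: "\<exists>j<rank \<sigma>. x j \<noteq> 0"
    "\<And>i. i < length hs \<Longrightarrow> (\<Sum>j = 0..<rank \<sigma>. (hs ! i) (frag_of (basis \<sigma> ! j)) * x j) = 0"
    using homogeneous_system[OF assms(1), of "\<lambda>i j. (hs ! i) (frag_of (basis \<sigma> ! j))"] by metis
  define y where "y = (\<Sum>j = 0..<rank \<sigma>. frag_cmul (x j) (frag_of (basis \<sigma> ! j)))"
  have y: "y \<in> L" unfolding y_def lattice_def
    by (intro sum_closed_free_Abelian_group) (use L_closed(3)[OF frag_of_in_L[OF basis_nth]] in \<open>simp add: lattice_def\<close>)
  have coord_y: "coord y (basis \<sigma> ! i) = x i" if "i < rank \<sigma>" for i
  proof -
    have "coord y (basis \<sigma> ! i) = (\<Sum>j = 0..<rank \<sigma>. if j = i then x i else 0)"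
      unfolding y_def lookup_sum
      by (intro sum.cong refl) (use that in \<open>auto simp: lookup_frag_of basis_nth_eq_iff\<close>)
    then show ?thesis using that by simp
  qed
  show thesis
  proof (rule that[OF y])
    show "y \<noteq> 0" using x(1) coord_y by (metis lookup_zero)
    fix h assume h: "h \<in> set hs"
    then obtain i where i: "i < length hs" "hs ! i = h" by (auto simp: in_set_conv_nth)
    have "h y = (\<Sum>j = 0..<rank \<sigma>. h (frag_of (basis \<sigma> ! j)) * x j)"
      unfolding lin[OF h y] sum_basis_nth by (simp add: coord_y mult.commute)
    then show "h y = 0" using x(2)[OF i(1)] i(2) by simp
  qed
qed

section \<open>Short factorisations\<close>

text \<open>The conditions on \<open>y\<close> are orthogonality to the roots of \<open>ts\<close>, and vanishing of the coordinates at
  \<open>\<alpha>\<^sub>0\<close> and \<open>\<alpha>\<^bsub>0*\<^esub>\<close>.  The latter two keep \<open>y\<close> out of the radical, so that \<open>c\<close> moves \<open>y\<close>; by the former,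
  \<open>c\<close> moves \<open>y\<close> like \<open>t\<close> alone, hence along the root of \<open>t\<close>.\<close>

lemma short_factorization_gives_root:
  assumes tub: "tubular \<sigma>" and ts: "set (t # ts) \<subseteq> reflections \<sigma> \<kappa>"
    and c: "product_list G (t # ts) = c" and len: "length ts + 2 < rank \<sigma>"
  obtains \<beta> where "\<beta> \<in> roots" "radical_orth \<beta>"
proof -
  have "\<forall>u\<in>reflections \<sigma> \<kappa>. \<exists>\<beta>. \<beta> \<in> roots \<and> (\<forall>y\<in>L. \<exists>k. u y = y - frag_cmul k \<beta> \<and> k * K \<beta> \<beta> = B y \<beta>)"
    using reflection_has_root by metis
  then obtain rt where rt: "\<And>u. u \<in> reflections \<sigma> \<kappa> \<Longrightarrow> rt u \<in> roots"
    "\<And>u y. u \<in> reflections \<sigma> \<kappa> \<Longrightarrow> y \<in> L \<Longrightarrow> \<exists>k. u y = y - frag_cmul k (rt u) \<and> k * K (rt u) (rt u) = B y (rt u)"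
    by metis
  define hs where "hs = (\<lambda>y. coord y Zero) # (\<lambda>y. coord y ZeroStar) # map (\<lambda>u y. B y (rt u)) ts"
  have "length hs < rank \<sigma>" using len by (simp add: hs_def)
  moreover have "h y = (\<Sum>v\<in>V. coord y v * h (frag_of v))" if "h \<in> set hs" for h y
  proof -
    have "coord y w = (\<Sum>v\<in>V. coord y v * coord (frag_of v) w)" if "w \<in> V" for w
    proof -
      have "(\<Sum>v\<in>V. coord y v * coord (frag_of v) w) = (\<Sum>v\<in>V. if v = w then coord y w else 0)"
        by (intro sum.cong refl) (simp add: lookup_frag_of)
      then show ?thesis using that by simp
    qed
    moreover have "h = (\<lambda>y. coord y Zero) \<or> h = (\<lambda>y. coord y ZeroStar) \<or> (\<exists>u. h = (\<lambda>y. B y (rt u)))"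
      using that by (auto simp: hs_def)
    ultimately show ?thesis
      using special_vertices B_expand_left[of y] by (elim disjE exE) simp_all
  qed
  ultimately obtain y where y: "y \<in> L" "y \<noteq> 0" and hy: "\<And>h. h \<in> set hs \<Longrightarrow> h y = 0"
    by (rule common_zero) (assumption, rule that)
  have y0: "coord y Zero = 0" "coord y ZeroStar = 0" and By: "\<And>u. u \<in> set ts \<Longrightarrow> B y (rt u) = 0"
    using hy by (auto simp: hs_def)
  have tsG: "set ts \<subseteq> carrier G" "t \<in> carrier G" using ts reflections_closed by auto
  have "product_list G us y = y" if "set us \<subseteq> set ts" for us
    using that
  proof (induction us)
    case Nil
    then show ?case using y by (simp add: product_list_def G_one)
  next
    case (Cons u us)
    then have u: "u \<in> reflections \<sigma> \<kappa>" "u \<in> set ts" using ts by auto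
    obtain k where k: "u y = y - frag_cmul k (rt u)" "k * K (rt u) (rt u) = B y (rt u)"
      using rt(2)[OF u(1) y(1)] by blast
    then have "k = 0" using By[OF u(2)] root_norm_pos[OF rt(1)[OF u(1)]] by simp
    then have "u y = y" using k by simp
    moreover have "product_list G us \<in> carrier G" "u \<in> carrier G"
      using Cons.prems tsG by (auto intro!: product_list_closed)
    ultimately show ?case using Cons y(1) by (simp add: product_list_Cons G_mult)
  qed
  then have "c y = t y"
    using tsG y(1) product_list_closed[OF tsG(1)] by (simp add: product_list_Cons G_mult flip: c)
  then obtain k where k: "y - c y = frag_cmul k (rt t)"
    using rt(2)[of t y] ts y(1) by auto
  have "k \<noteq> 0"
    using coxeter_fixed_eq_0[OF y(1) _ y0] y(2) k by auto
  have K: "k * K (frag_of v) (rt t) = B y (frag_of v)" if "v \<in> V" for v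
    using K_coxeter[OF that y(1)] unfolding k by (simp add: Kform_cmul Bform_sym)
  have "k * K (frag_of ZeroStar) (rt t) = k * (\<epsilon> * K (frag_of Zero) (rt t))"
    using K[OF special_vertices(1)] K[OF special_vertices(2)] B_Zero(2)[OF y(1)]
    by (simp add: mult.left_commute)
  moreover have "real_of_int k * (\<Sum>v\<in>V. radical_weight v * K (frag_of v) (rt t)) = 0"
  proof -
    have "real_of_int k * (\<Sum>v\<in>V. radical_weight v * K (frag_of v) (rt t)) =
        (\<Sum>v\<in>V. radical_weight v * real_of_int (k * K (frag_of v) (rt t)))"
      by (simp add: sum_distrib_left mult_ac)
    also have "\<dots> = (\<Sum>v\<in>V. radical_weight v * B y (frag_of v))"
      by (intro sum.cong refl) (simp only: K)
    also have "\<dots> = 0" by (rule sum_radical_weight_B[OF tub y(1)])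
    finally show ?thesis .
  qed
  ultimately have "radical_orth (rt t)"
    using \<open>k \<noteq> 0\<close> by (simp add: radical_orth_def)
  then show thesis using that[of "rt t"] rt(1)[of t] ts by simp
qed

lemma factorization_length_ge:
  assumes tub: "tubular \<sigma>" and ts: "set ts \<subseteq> reflections \<sigma> \<kappa>" and c: "product_list G ts = c"
  shows "rank \<sigma> \<le> length ts"
proof (rule ccontr)
  assume "\<not> rank \<sigma> \<le> length ts"
  then have lt: "length ts < rank \<sigma>" by simp
  have simple: "set (map s (basis \<sigma>)) \<subseteq> reflections \<sigma> \<kappa>"
    using simple_in_reflections by auto
  (* Both sides are the determinant of c. *)
  have "(-1 :: int) ^ length ts = (-1) ^ rank \<sigma>"
    using det_product_list[OF ts] det_product_list[OF simple] c
    by (simp add: coxeter_def length_basis)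
  then have "even (length ts) = even (rank \<sigma>)"
    by (metis minus_one_power_iff one_neq_neg_one)
  (* Parity excludes n - 1, which leaves room for the two normalizing equations. *)
  then have "length ts \<noteq> rank \<sigma> - 1" using lt by (cases "rank \<sigma>") auto
  with lt have len: "length ts + 1 < rank \<sigma>" by simp
  show False
  proof (cases ts)
    case Nil
    have "frag_of Zero \<in> L" using frag_of_in_L special_vertices by blast
    then have "c (frag_of Zero) = frag_of Zero"
      using c Nil by (simp add: product_list_def G_one flip: c)
    then have "B (frag_of Zero) (frag_of Zero) = 0"
      using K_coxeter[OF special_vertices(1) \<open>frag_of Zero \<in> L\<close>] by (simp add: Kform_zero)
    then show False using gram_pos[OF special_vertices(1)] B_simple[OF special_vertices(1)] by simp
  next
    case (Cons t ts')
    then show False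
      using short_factorization_gives_root[OF tub, of t ts'] ts c len no_root_radical_orth[OF tub]
      by auto
  qed
qed

theorem reflection_length_coxeter:
  assumes "tubular \<sigma>"
  shows "reflection_length \<sigma> \<kappa> c = rank \<sigma>"
  unfolding reflection_length_def
proof (rule Least_equality)
  show "\<exists>ts. length ts = rank \<sigma> \<and> set ts \<subseteq> reflections \<sigma> \<kappa> \<and> product_list G ts = c"
    using simple_in_reflections
    by (intro exI[of _ "map s (basis \<sigma>)"]) (auto simp: coxeter_def length_basis)
qed (use factorization_length_ge[OF assms] in auto)

end

theorem proposition5p19:
  fixes \<sigma> :: symbol and \<kappa> :: nat
  assumes "is_symbol \<sigma>" and "tubular \<sigma>" and "admissible \<sigma> \<kappa>"
  shows "reflection_length \<sigma> \<kappa> (coxeter \<sigma> \<kappa>) = rank \<sigma>"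
  using canonical_lattice.reflection_length_coxeter[of \<sigma> \<kappa>] assms
  by (simp add: canonical_lattice_def)

end
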